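(* Let $L$ be a finite-dimensional solvable Lie algebra over a field $F$ with $L \in \mathcal{N}(\leq 2)$, and let $\overline{S}$ denote the image of a subalgebra $S$ of $L$ under the canonical homomorphism $L\to L/\phi(L)$. Then $L$ is extreme if and only if one of the following holds: (i) $\dim L=1$; or (ii) $\overline{L}=\overline{A} \dot{+} \overline{U}$, where $\overline{A}=\overline{N(L)}$ is the monolith of $\overline{L}$ and $\overline{U}$ is a one-dimensional subalgebra of $\overline{L}$ which acts irreducibly on $\overline{A}$.
   Context: $N(L)$ is the nilradical of $L$; the upper nilpotent series is $N_0(L)=0$, $N_i(L)/N_{i-1}(L)=N(L/N_{i-1}(L))$, and the nilpotent length $n(L)$ is the smallest integer $m$ with $N_m(L)=L$. $\mathcal{N}(\leq k)$ is the class of Lie algebras of nilpotent length $\leq k$. The Frattini subalgebra $\phi(L)$ is the intersection of the maximal subalgebras of $L$ (an ideal, since $L$ is solvable), and $\phi_i(L)/N_{i-1}(L)=\phi(L/N_{i-1}(L))$ for $i=1,2,\ldots$. For ideals $B\subset A$ of $L$, $A/B$ is a chief factor of $L$ if it is a minimal ideal of $L/B$. $L$ is extreme if $N_i(L)/\phi_i(L)$ is a chief factor of $L$ for each $i=1,\ldots,n(L)$. A Lie algebra is monolithic if it has a unique minimal ideal, called its monolith. $\dot{+}$ denotes a direct sum of underlying vector spaces.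
   Formalization: The Lie algebra L is assumed to be nonzero: for L = 0 the nilpotent length is 0, so L is vacuously extreme, while neither (i) nor (ii) holds. *)

theory Defs
  imports "HOL-Algebra.QuotRing" "Jordan_Normal_Form.Missing_VectorSpace"
begin

text \<open>
  A Lie algebra is carried by a module record extended with a bracket. As for every module record,
  the inherited ring components \<open>mult\<close> and \<open>one\<close> play no role.
\<close>

record ('a, 'b) lie_struct = "('a, 'b) module" +
  lie_bracket :: "['b, 'b] \<Rightarrow> 'b"  ("\<lblot>_, _\<rblot>\<index>")

locale lie_algebra = vectorspace F L
  for F :: "('a, 'm) ring_scheme" and L :: "('a, 'b) lie_struct" +
  assumes lie_closed:
      "\<lbrakk>x \<in> carrier L; y \<in> carrier L\<rbrakk> \<Longrightarrow> \<lblot>x, y\<rblot>\<^bsub>L\<^esub> \<in> carrier L"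
    and lie_add_left:
      "\<lbrakk>x \<in> carrier L; y \<in> carrier L; z \<in> carrier L\<rbrakk> \<Longrightarrow>
        \<lblot>x \<oplus>\<^bsub>L\<^esub> y, z\<rblot>\<^bsub>L\<^esub> = \<lblot>x, z\<rblot>\<^bsub>L\<^esub> \<oplus>\<^bsub>L\<^esub> \<lblot>y, z\<rblot>\<^bsub>L\<^esub>"
    and lie_add_right:
      "\<lbrakk>x \<in> carrier L; y \<in> carrier L; z \<in> carrier L\<rbrakk> \<Longrightarrow>
        \<lblot>x, y \<oplus>\<^bsub>L\<^esub> z\<rblot>\<^bsub>L\<^esub> = \<lblot>x, y\<rblot>\<^bsub>L\<^esub> \<oplus>\<^bsub>L\<^esub> \<lblot>x, z\<rblot>\<^bsub>L\<^esub>"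
    and lie_smult_left:
      "\<lbrakk>a \<in> carrier F; x \<in> carrier L; y \<in> carrier L\<rbrakk> \<Longrightarrow>
        \<lblot>a \<odot>\<^bsub>L\<^esub> x, y\<rblot>\<^bsub>L\<^esub> = a \<odot>\<^bsub>L\<^esub> \<lblot>x, y\<rblot>\<^bsub>L\<^esub>"
    and lie_smult_right:
      "\<lbrakk>a \<in> carrier F; x \<in> carrier L; y \<in> carrier L\<rbrakk> \<Longrightarrow>
        \<lblot>x, a \<odot>\<^bsub>L\<^esub> y\<rblot>\<^bsub>L\<^esub> = a \<odot>\<^bsub>L\<^esub> \<lblot>x, y\<rblot>\<^bsub>L\<^esub>"
    and lie_alternating:
      "x \<in> carrier L \<Longrightarrow> \<lblot>x, x\<rblot>\<^bsub>L\<^esub> = \<zero>\<^bsub>L\<^esub>"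
    and lie_jacobi:
      "\<lbrakk>x \<in> carrier L; y \<in> carrier L; z \<in> carrier L\<rbrakk> \<Longrightarrow>
        \<lblot>x, \<lblot>y, z\<rblot>\<^bsub>L\<^esub>\<rblot>\<^bsub>L\<^esub> \<oplus>\<^bsub>L\<^esub> \<lblot>y, \<lblot>z, x\<rblot>\<^bsub>L\<^esub>\<rblot>\<^bsub>L\<^esub> \<oplus>\<^bsub>L\<^esub> \<lblot>z, \<lblot>x, y\<rblot>\<^bsub>L\<^esub>\<rblot>\<^bsub>L\<^esub> = \<zero>\<^bsub>L\<^esub>"

definition lie_subalgebra ::
    "('a, 'm) ring_scheme \<Rightarrow> ('a, 'b) lie_struct \<Rightarrow> 'b set \<Rightarrow> bool" where
  "lie_subalgebra F L S \<longleftrightarrow> subspace F S L \<and> (\<forall>x\<in>S. \<forall>y\<in>S. \<lblot>x, y\<rblot>\<^bsub>L\<^esub> \<in> S)"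

definition lie_ideal ::
    "('a, 'm) ring_scheme \<Rightarrow> ('a, 'b) lie_struct \<Rightarrow> 'b set \<Rightarrow> bool" where
  "lie_ideal F L I \<longleftrightarrow> subspace F I L \<and> (\<forall>x\<in>carrier L. \<forall>y\<in>I. \<lblot>x, y\<rblot>\<^bsub>L\<^esub> \<in> I)"

definition lie_product ::
    "('a, 'm) ring_scheme \<Rightarrow> ('a, 'b) lie_struct \<Rightarrow> 'b set \<Rightarrow> 'b set \<Rightarrow> 'b set" where
  "lie_product F L A B = module.span F L {\<lblot>x, y\<rblot>\<^bsub>L\<^esub> | x y. x \<in> A \<and> y \<in> B}"

primrec derived_series ::
    "('a, 'm) ring_scheme \<Rightarrow> ('a, 'b) lie_struct \<Rightarrow> nat \<Rightarrow> 'b set" where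
  "derived_series F L 0 = carrier L"
| "derived_series F L (Suc k) = lie_product F L (derived_series F L k) (derived_series F L k)"

definition lie_solvable :: "('a, 'm) ring_scheme \<Rightarrow> ('a, 'b) lie_struct \<Rightarrow> bool" where
  "lie_solvable F L \<longleftrightarrow> (\<exists>k. derived_series F L k = {\<zero>\<^bsub>L\<^esub>})"

text \<open>The lower central series and nilpotency of a subalgebra \<open>S\<close> of \<open>L\<close>, as a Lie algebra in its own right.\<close>

primrec lower_central_series ::
    "('a, 'm) ring_scheme \<Rightarrow> ('a, 'b) lie_struct \<Rightarrow> 'b set \<Rightarrow> nat \<Rightarrow> 'b set" where
  "lower_central_series F L S 0 = S"
| "lower_central_series F L S (Suc k) = lie_product F L S (lower_central_series F L S k)"

definition lie_nilpotent ::
    "('a, 'm) ring_scheme \<Rightarrow> ('a, 'b) lie_struct \<Rightarrow> 'b set \<Rightarrow> bool" where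
  "lie_nilpotent F L S \<longleftrightarrow> (\<exists>k. lower_central_series F L S k = {\<zero>\<^bsub>L\<^esub>})"

text \<open>
  The nilradical is the sum of all nilpotent ideals; in finite dimension it is itself nilpotent,
  hence the largest nilpotent ideal.
\<close>

definition nilradical :: "('a, 'm) ring_scheme \<Rightarrow> ('a, 'b) lie_struct \<Rightarrow> 'b set" where
  "nilradical F L = module.span F L (\<Union>{I. lie_ideal F L I \<and> lie_nilpotent F L I})"

definition maximal_subalgebra ::
    "('a, 'm) ring_scheme \<Rightarrow> ('a, 'b) lie_struct \<Rightarrow> 'b set \<Rightarrow> bool" where
  "maximal_subalgebra F L M \<longleftrightarrow> lie_subalgebra F L M \<and> M \<noteq> carrier L \<and>
     (\<forall>S. lie_subalgebra F L S \<and> M \<subseteq> S \<longrightarrow> S = M \<or> S = carrier L)"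

text \<open>Intersecting with the carrier only matters for \<open>L = 0\<close>, which has no maximal subalgebra.\<close>

definition frattini :: "('a, 'm) ring_scheme \<Rightarrow> ('a, 'b) lie_struct \<Rightarrow> 'b set" where
  "frattini F L = carrier L \<inter> \<Inter>{M. maximal_subalgebra F L M}"

text \<open>
  The quotient by an ideal consists of additive cosets, as for \<^const>\<open>FactRing\<close>. The unions are
  unions of equal cosets when \<open>I\<close> is an ideal.
\<close>

definition lie_quotient :: "('a, 'b) lie_struct \<Rightarrow> 'b set \<Rightarrow> ('a, 'b set) lie_struct" where
  "lie_quotient L I =
     \<lparr>carrier = a_rcosets\<^bsub>L\<^esub> I, mult = undefined, one = undefined,
      zero = I, add = set_add L,
      smult = (\<lambda>a X. \<Union>x\<in>X. I +>\<^bsub>L\<^esub> (a \<odot>\<^bsub>L\<^esub> x)),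
      lie_bracket = (\<lambda>X Y. \<Union>x\<in>X. \<Union>y\<in>Y. I +>\<^bsub>L\<^esub> \<lblot>x, y\<rblot>\<^bsub>L\<^esub>)\<rparr>"

definition quotient_image :: "('a, 'b) lie_struct \<Rightarrow> 'b set \<Rightarrow> 'b set \<Rightarrow> 'b set set" where
  "quotient_image L I S = (\<lambda>x. I +>\<^bsub>L\<^esub> x) ` S"

primrec upper_nilpotent_series ::
    "('a, 'm) ring_scheme \<Rightarrow> ('a, 'b) lie_struct \<Rightarrow> nat \<Rightarrow> 'b set" where
  "upper_nilpotent_series F L 0 = {\<zero>\<^bsub>L\<^esub>}"
| "upper_nilpotent_series F L (Suc i) =
     {x \<in> carrier L. upper_nilpotent_series F L i +>\<^bsub>L\<^esub> x
        \<in> nilradical F (lie_quotient L (upper_nilpotent_series F L i))}"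

definition nilpotent_length :: "('a, 'm) ring_scheme \<Rightarrow> ('a, 'b) lie_struct \<Rightarrow> nat" where
  "nilpotent_length F L = (LEAST m. upper_nilpotent_series F L m = carrier L)"

text \<open>The first conjunct guarantees that the nilpotent length is defined.\<close>

definition nilpotent_length_le ::
    "('a, 'm) ring_scheme \<Rightarrow> ('a, 'b) lie_struct \<Rightarrow> nat \<Rightarrow> bool" where
  "nilpotent_length_le F L k \<longleftrightarrow>
     (\<exists>m. upper_nilpotent_series F L m = carrier L) \<and> nilpotent_length F L \<le> k"

text \<open>Only meaningful for \<open>i \<ge> 1\<close>.\<close>

definition frattini_series ::
    "('a, 'm) ring_scheme \<Rightarrow> ('a, 'b) lie_struct \<Rightarrow> nat \<Rightarrow> 'b set" where
  "frattini_series F L i =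
     {x \<in> carrier L. upper_nilpotent_series F L (i - 1) +>\<^bsub>L\<^esub> x
        \<in> frattini F (lie_quotient L (upper_nilpotent_series F L (i - 1)))}"

definition minimal_ideal ::
    "('a, 'm) ring_scheme \<Rightarrow> ('a, 'b) lie_struct \<Rightarrow> 'b set \<Rightarrow> bool" where
  "minimal_ideal F L I \<longleftrightarrow> lie_ideal F L I \<and> I \<noteq> {\<zero>\<^bsub>L\<^esub>} \<and>
     (\<forall>J. lie_ideal F L J \<and> J \<subseteq> I \<longrightarrow> J = {\<zero>\<^bsub>L\<^esub>} \<or> J = I)"

text \<open>\<open>chief_factor F L A B\<close> states that \<open>A/B\<close> is a chief factor of \<open>L\<close>.\<close>

definition chief_factor ::
    "('a, 'm) ring_scheme \<Rightarrow> ('a, 'b) lie_struct \<Rightarrow> 'b set \<Rightarrow> 'b set \<Rightarrow> bool" where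
  "chief_factor F L A B \<longleftrightarrow> lie_ideal F L A \<and> lie_ideal F L B \<and> B \<subseteq> A \<and>
     minimal_ideal F (lie_quotient L B) (quotient_image L B A)"

definition extreme :: "('a, 'm) ring_scheme \<Rightarrow> ('a, 'b) lie_struct \<Rightarrow> bool" where
  "extreme F L \<longleftrightarrow> (\<forall>i\<in>{1..nilpotent_length F L}.
     chief_factor F L (upper_nilpotent_series F L i) (frattini_series F L i))"

text \<open>\<open>is_monolith F L A\<close> states that \<open>L\<close> is monolithic with monolith \<open>A\<close>.\<close>

definition is_monolith ::
    "('a, 'm) ring_scheme \<Rightarrow> ('a, 'b) lie_struct \<Rightarrow> 'b set \<Rightarrow> bool" where
  "is_monolith F L A \<longleftrightarrow> minimal_ideal F L A \<and> (\<forall>I. minimal_ideal F L I \<longrightarrow> I = A)"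

definition is_direct_sum :: "('a, 'b) lie_struct \<Rightarrow> 'b set \<Rightarrow> 'b set \<Rightarrow> bool" where
  "is_direct_sum L A U \<longleftrightarrow> A <+>\<^bsub>L\<^esub> U = carrier L \<and> A \<inter> U = {\<zero>\<^bsub>L\<^esub>}"

definition acts_irreducibly ::
    "('a, 'm) ring_scheme \<Rightarrow> ('a, 'b) lie_struct \<Rightarrow> 'b set \<Rightarrow> 'b set \<Rightarrow> bool" where
  "acts_irreducibly F L U A \<longleftrightarrow>
     subspace F A L \<and> (\<forall>u\<in>U. \<forall>a\<in>A. \<lblot>u, a\<rblot>\<^bsub>L\<^esub> \<in> A) \<and> A \<noteq> {\<zero>\<^bsub>L\<^esub>} \<and>
     (\<forall>W. subspace F W L \<and> W \<subseteq> A \<and> (\<forall>u\<in>U. \<forall>w\<in>W. \<lblot>u, w\<rblot>\<^bsub>L\<^esub> \<in> W)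
        \<longrightarrow> W = {\<zero>\<^bsub>L\<^esub>} \<or> W = A)"

end

theory Submission
  imports Defs
begin

text \<open>
  If \<open>A/B\<close> is a chief factor at the top of a solvable algebra, it is one-dimensional; by the
  non-generator property of the Frattini subalgebra, extremality at the top level then means
  \<open>L = N + Fx\<close>, where \<open>N\<close> is the nilradical (or \<open>L = Fx\<close> if \<open>L\<close> is nilpotent). At the bottom level
  \<open>N/\<phi>(L)\<close> is an abelian chief factor, so the only thing left to exclude is that \<open>x\<close> centralises it.
  In that case \<open>[x, L] \<subseteq> \<phi>(L)\<close>, so \<open>ad x\<close> is nilpotent by Fitting's lemma, and \<open>L = N + Fx\<close> would be
  nilpotent. Conversely, one needs that \<open>\<phi>(L)\<close> is an ideal (Barnes' argument: conjugating a
  maximal subalgebra by \<open>1 + ad a\<close>) and that it is contained in \<open>N\<close> (Fitting's lemma again).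
\<close>

section \<open>Subspaces of a vector space\<close>

text \<open>Conjugation by \<open>1 + ad a\<close> therefore takes place modulo an ideal
  \<open>K\<close> maximal among those inside the given maximal subalgebra, with \<open>a\<close> in
  an ideal \<open>A\<close> minimal above \<open>K\<close>. Solvability makes \<open>A/K\<close>
  abelian, so \<open>(ad a)^2\<close> vanishes modulo \<open>K\<close> and \<open>1 + ad a\<close>
  is already an automorphism of \<open>L/K\<close>. The bound on the nilpotent length makes
  \<open>L/N\<close> nilpotent, which is what the proof of \<phi>(L) \<subseteq> N rests on. That
  \<open>N + Fx\<close> is nilpotent, and likewise a sum of two nilpotent ideals, comes from one
  construction: a filtration of \<open>L\<close> that the new elements push down is interleaved with
  the lower central series of \<open>N\<close>. Chief factors, Frattini subalgebras and nilpotency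
  of quotients are rewritten as conditions on subspaces of \<open>L\<close> itself; cosets return
  only for the assertions about \<open>L/\<phi>(L)\<close>.\<close>

context vectorspace
begin

lemma subspace_iff:
  "subspace K W V \<longleftrightarrow> W \<subseteq> carrier V \<and> \<zero>\<^bsub>V\<^esub> \<in> W \<and> (\<forall>x\<in>W. \<forall>y\<in>W. x \<oplus>\<^bsub>V\<^esub> y \<in> W) \<and>
    (\<forall>c\<in>carrier K. \<forall>x\<in>W. c \<odot>\<^bsub>V\<^esub> x \<in> W)"
  using vectorspace_axioms module_axioms
  by (auto simp: subspace_def LinearCombinations.submodule_def)

lemma subspaceI:
  assumes "W \<subseteq> carrier V" "\<zero>\<^bsub>V\<^esub> \<in> W" "\<And>x y. x \<in> W \<Longrightarrow> y \<in> W \<Longrightarrow> x \<oplus>\<^bsub>V\<^esub> y \<in> W"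
    "\<And>c x. c \<in> carrier K \<Longrightarrow> x \<in> W \<Longrightarrow> c \<odot>\<^bsub>V\<^esub> x \<in> W"
  shows "subspace K W V"
  using assms by (auto simp: subspace_iff)

lemma subspaceD:
  assumes "subspace K W V"
  shows "W \<subseteq> carrier V" "x \<in> W \<Longrightarrow> x \<in> carrier V" "\<zero>\<^bsub>V\<^esub> \<in> W"
    "x \<in> W \<Longrightarrow> y \<in> W \<Longrightarrow> x \<oplus>\<^bsub>V\<^esub> y \<in> W"
    "c \<in> carrier K \<Longrightarrow> x \<in> W \<Longrightarrow> c \<odot>\<^bsub>V\<^esub> x \<in> W"
  using assms by (auto simp: subspace_iff)

lemma subspace_neg: "subspace K W V \<Longrightarrow> x \<in> W \<Longrightarrow> \<ominus>\<^bsub>V\<^esub> x \<in> W"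
  by (metis R.add.inv_closed one_closed smult_minus_1 subspaceD(2,5))

lemma subspace_minus: "subspace K W V \<Longrightarrow> x \<in> W \<Longrightarrow> y \<in> W \<Longrightarrow> x \<ominus>\<^bsub>V\<^esub> y \<in> W"
  by (simp add: a_minus_def subspaceD subspace_neg)

lemma subspace_add_cancel_right:
  assumes "subspace K W V" "x \<in> carrier V" "y \<in> W"
  shows "x \<oplus>\<^bsub>V\<^esub> y \<in> W \<longleftrightarrow> x \<in> W"
proof
  assume "x \<oplus>\<^bsub>V\<^esub> y \<in> W"
  then have "(x \<oplus>\<^bsub>V\<^esub> y) \<ominus>\<^bsub>V\<^esub> y \<in> W"
    by (rule subspace_minus[OF assms(1) _ assms(3)])
  moreover have "(x \<oplus>\<^bsub>V\<^esub> y) \<ominus>\<^bsub>V\<^esub> y = x"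
    using assms subspaceD(2)[OF assms(1)] by (simp add: a_minus_def M.a_assoc M.r_neg)
  ultimately show "x \<in> W" by simp
qed (simp add: assms subspaceD[OF assms(1)])

lemma subspace_add_cancel_left:
  assumes "subspace K W V" "x \<in> carrier V" "y \<in> W"
  shows "y \<oplus>\<^bsub>V\<^esub> x \<in> W \<longleftrightarrow> x \<in> W"
  using subspace_add_cancel_right[OF assms] assms subspaceD(2)[OF assms(1)] by (simp add: M.a_comm)

lemma subspace_neg_iff: "subspace K W V \<Longrightarrow> x \<in> carrier V \<Longrightarrow> \<ominus>\<^bsub>V\<^esub> x \<in> W \<longleftrightarrow> x \<in> W"
  by (metis M.minus_minus subspace_neg)

lemma subspace_minus_cancel:
  assumes "subspace K W V" "x \<in> carrier V" "y \<in> W"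
  shows "x \<ominus>\<^bsub>V\<^esub> y \<in> W \<longleftrightarrow> x \<in> W" "y \<ominus>\<^bsub>V\<^esub> x \<in> W \<longleftrightarrow> x \<in> W"
  using assms subspaceD(2)[OF assms(1)]
  by (simp_all add: a_minus_def subspace_add_cancel_left subspace_add_cancel_right subspace_neg subspace_neg_iff)

lemma subspace_smult_iff:
  assumes "subspace K W V" "x \<in> carrier V" "c \<in> carrier K" "c \<noteq> \<zero>\<^bsub>K\<^esub>"
  shows "c \<odot>\<^bsub>V\<^esub> x \<in> W \<longleftrightarrow> x \<in> W"
proof
  assume "c \<odot>\<^bsub>V\<^esub> x \<in> W"
  then have "inv\<^bsub>K\<^esub> c \<odot>\<^bsub>V\<^esub> (c \<odot>\<^bsub>V\<^esub> x) \<in> W" using assms by (simp add: subspaceD)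
  then show "x \<in> W" using mult_inverse[OF assms(3,2) refl assms(4)] by simp
qed (use assms in \<open>simp add: subspaceD\<close>)

lemma subspace_carrier: "subspace K (carrier V) V"
  by (rule subspaceI) auto

lemma subspace_zero: "subspace K {\<zero>\<^bsub>V\<^esub>} V"
  by (rule subspaceI) auto

lemma subspace_Int: "subspace K A V \<Longrightarrow> subspace K B V \<Longrightarrow> subspace K (A \<inter> B) V"
  by (auto simp: subspace_iff)

lemma subspace_Inter: "(\<And>A. A \<in> \<A> \<Longrightarrow> subspace K A V) \<Longrightarrow> subspace K (carrier V \<inter> \<Inter>\<A>) V"
  by (auto simp: subspace_iff)

lemma mem_set_add: "z \<in> A <+>\<^bsub>V\<^esub> B \<longleftrightarrow> (\<exists>a\<in>A. \<exists>b\<in>B. z = a \<oplus>\<^bsub>V\<^esub> b)"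
  by (auto simp: set_add_def')

lemma subspace_set_add:
  assumes "subspace K A V" "subspace K B V"
  shows "subspace K (A <+>\<^bsub>V\<^esub> B) V"
proof -
  have "A <+>\<^bsub>V\<^esub> B = subspace_sum A B"
    by (auto simp: set_add_def' submodule_sum_def)
  then show ?thesis using sum_is_subspace[OF assms] by simp
qed

lemma set_add_upper:
  assumes "subspace K A V" "subspace K B V"
  shows "A \<subseteq> A <+>\<^bsub>V\<^esub> B" "B \<subseteq> A <+>\<^bsub>V\<^esub> B"
proof -
  have "x = x \<oplus>\<^bsub>V\<^esub> \<zero>\<^bsub>V\<^esub>" if "x \<in> A" for x
    using that subspaceD(2)[OF assms(1)] by simp
  then show "A \<subseteq> A <+>\<^bsub>V\<^esub> B"
    using subspaceD(3)[OF assms(2)] unfolding mem_set_add subset_iff by blast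
  have "x = \<zero>\<^bsub>V\<^esub> \<oplus>\<^bsub>V\<^esub> x" if "x \<in> B" for x
    using that subspaceD(2)[OF assms(2)] by simp
  then show "B \<subseteq> A <+>\<^bsub>V\<^esub> B"
    using subspaceD(3)[OF assms(1)] unfolding mem_set_add subset_iff by blast
qed

lemma set_add_least:
  assumes "subspace K W V" "A \<subseteq> W" "B \<subseteq> W"
  shows "A <+>\<^bsub>V\<^esub> B \<subseteq> W"
  using assms(2,3) subspaceD(4)[OF assms(1)] unfolding mem_set_add subset_iff by blast

lemma span_subset_iff:
  assumes "subspace K W V" "S \<subseteq> carrier V"
  shows "span S \<subseteq> W \<longleftrightarrow> S \<subseteq> W"
  using assms span_is_subset[of S W] in_own_span[of S] by (auto simp: subspace_def)

lemma span_subspace: "subspace K W V \<Longrightarrow> span W = W"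
  by (meson in_own_span span_subset_iff subset_antisym subspaceD(1) subset_refl)

lemma mem_span_singleton:
  assumes "x \<in> carrier V"
  shows "y \<in> span {x} \<longleftrightarrow> (\<exists>c\<in>carrier K. y = c \<odot>\<^bsub>V\<^esub> x)"
proof
  have "subspace K {c \<odot>\<^bsub>V\<^esub> x | c. c \<in> carrier K} V" (is "subspace K ?S V")
  proof (rule subspaceI)
    show "\<zero>\<^bsub>V\<^esub> \<in> ?S" using assms smult_l_null by force
  next
    fix a b assume "a \<in> ?S" "b \<in> ?S"
    then obtain c d where "c \<in> carrier K" "d \<in> carrier K" "a = c \<odot>\<^bsub>V\<^esub> x" "b = d \<odot>\<^bsub>V\<^esub> x" by blast
    then have "c \<oplus>\<^bsub>K\<^esub> d \<in> carrier K" "a \<oplus>\<^bsub>V\<^esub> b = (c \<oplus>\<^bsub>K\<^esub> d) \<odot>\<^bsub>V\<^esub> x"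
      using assms by (simp_all add: smult_l_distr)
    then show "a \<oplus>\<^bsub>V\<^esub> b \<in> ?S" by blast
  next
    fix a b assume "a \<in> carrier K" "b \<in> ?S"
    then obtain c where "c \<in> carrier K" "b = c \<odot>\<^bsub>V\<^esub> x" by blast
    with \<open>a \<in> carrier K\<close> have "a \<otimes>\<^bsub>K\<^esub> c \<in> carrier K" "a \<odot>\<^bsub>V\<^esub> b = (a \<otimes>\<^bsub>K\<^esub> c) \<odot>\<^bsub>V\<^esub> x"
      using assms by (simp_all add: smult_assoc1)
    then show "a \<odot>\<^bsub>V\<^esub> b \<in> ?S" by blast
  qed (use assms in auto)
  moreover have "x \<in> {c \<odot>\<^bsub>V\<^esub> x | c. c \<in> carrier K}"
    using assms smult_one one_closed by force
  ultimately have "span {x} \<subseteq> {c \<odot>\<^bsub>V\<^esub> x | c. c \<in> carrier K}"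
    using assms by (subst span_subset_iff) auto
  then show "y \<in> span {x} \<Longrightarrow> \<exists>c\<in>carrier K. y = c \<odot>\<^bsub>V\<^esub> x" by auto
next
  assume "\<exists>c\<in>carrier K. y = c \<odot>\<^bsub>V\<^esub> x"
  then show "y \<in> span {x}"
    using assms span_is_subspace[of "{x}"] span_self[of x] subspaceD(5) by blast
qed

lemma mem_set_add_span_singleton:
  assumes "x \<in> carrier V"
  shows "y \<in> A <+>\<^bsub>V\<^esub> span {x} \<longleftrightarrow> (\<exists>a\<in>A. \<exists>c\<in>carrier K. y = a \<oplus>\<^bsub>V\<^esub> c \<odot>\<^bsub>V\<^esub> x)"
proof -
  have "span {x} = (\<lambda>c. c \<odot>\<^bsub>V\<^esub> x) ` carrier K"
    by (auto simp: mem_span_singleton[OF assms])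
  then show ?thesis by (simp add: mem_set_add)
qed

section \<open>Rank of a subspace and chain conditions in finite dimension\<close>

definition subspace_rank :: "'c set \<Rightarrow> nat" where
  "subspace_rank W = Max (card ` {B. B \<subseteq> W \<and> lin_indpt B})"

text \<open>An independent subset of \<open>W\<close> of largest size spans \<open>W\<close>, since
  any vector outside its span could be adjoined. The rank is thus the dimension of \<open>W\<close>,
  but measured by independent sets of \<open>V\<close>, so that different subspaces are compared
  inside one structure.\<close>

lemma ex_subspace_basis:
  assumes fd: "fin_dim" and W: "subspace K W V"
  obtains B where "finite B" "B \<subseteq> W" "lin_indpt B" "span B = W" "card B = subspace_rank W"
proof -
  have fin: "finite (card ` {B. B \<subseteq> W \<and> lin_indpt B})"
    by (rule finite_subset[of _ "{..dim}"]) (use W fd li_le_dim subspaceD(1) in blast, simp)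
  have "lin_indpt {}" by (simp add: lin_dep_def)
  then have "card ` {B. B \<subseteq> W \<and> lin_indpt B} \<noteq> {}" by blast
  from Max_in[OF fin this]
  obtain B where B: "B \<subseteq> W" "lin_indpt B" "subspace_rank W = card B"
    unfolding subspace_rank_def by auto
  have BV: "B \<subseteq> carrier V" using B(1) W subspaceD(1) by blast
  have finB: "finite B" using li_le_dim(1)[OF fd BV B(2)] .
  have "W \<subseteq> span B"
  proof
    fix w assume w: "w \<in> W"
    show "w \<in> span B"
    proof (rule ccontr)
      assume nw: "w \<notin> span B"
      then have "w \<notin> B" using in_own_span[OF BV] by blast
      moreover have "w \<in> carrier V" using w W subspaceD(1) by blast
      ultimately have "lin_indpt (B \<union> {w})" using nw lin_dep_iff_in_span[OF BV B(2)] by simp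
      then have "card (B \<union> {w}) \<le> subspace_rank W" unfolding subspace_rank_def
        using B(1) w by (intro Max_ge fin imageI) auto
      with \<open>w \<notin> B\<close> finB B(3) show False by simp
    qed
  qed
  then have "span B = W" using span_subset_iff[OF W BV] B(1) by blast
  then show thesis using that[of B] finB B by simp
qed

lemma subspace_rank_strict_mono:
  assumes fd: "fin_dim" and W: "subspace K W V" and X: "subspace K X V" and WX: "W \<subset> X"
  shows "subspace_rank W < subspace_rank X"
proof -
  have fin: "finite (card ` {B. B \<subseteq> X \<and> lin_indpt B})"
    by (rule finite_subset[of _ "{..dim}"]) (use X fd li_le_dim subspaceD(1) in blast, simp)
  obtain B where B: "finite B" "B \<subseteq> W" "lin_indpt B" "span B = W" "card B = subspace_rank W"
    by (rule ex_subspace_basis[OF fd W])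
  obtain x where x: "x \<in> X" "x \<notin> W" using WX by blast
  have BV: "B \<subseteq> carrier V" using B(2) W subspaceD(1) by blast
  have "x \<notin> B" using x B(2) by blast
  moreover have "x \<in> carrier V" using x X subspaceD(1) by blast
  ultimately have li: "lin_indpt (B \<union> {x})"
    using lin_dep_iff_in_span[OF BV B(3)] x(2) B(4) by simp
  have "subspace_rank W < card (B \<union> {x})" using B(1,5) \<open>x \<notin> B\<close> by simp
  also have "\<dots> \<le> subspace_rank X" unfolding subspace_rank_def
    using li B(2) x(1) WX by (intro Max_ge fin imageI) auto
  finally show ?thesis .
qed

lemma subspace_rank_le_dim:
  assumes fd: "fin_dim" and W: "subspace K W V" shows "subspace_rank W \<le> dim"
proof -
  obtain B where B: "B \<subseteq> W" "lin_indpt B" "card B = subspace_rank W"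
    by (rule ex_subspace_basis[OF fd W])
  then show ?thesis using li_le_dim(2)[OF fd _ B(2)] subspaceD(1)[OF W] by auto
qed

text \<open>This is the descending chain condition in the form in which finite dimension is used: a
  member of least rank has no proper submember. The predicate may describe ideals, subalgebras,
  kernels or images.\<close>

lemma ex_minimal_subspace:
  assumes fd: "fin_dim" and sub: "\<And>W. P W \<Longrightarrow> subspace K W V" and "P X"
  obtains W where "P W" "\<And>Y. P Y \<Longrightarrow> Y \<subseteq> W \<Longrightarrow> Y = W"
proof -
  obtain W where "P W" "\<And>Y. P Y \<Longrightarrow> subspace_rank W \<le> subspace_rank Y"
    using ex_has_least_nat[of P X subspace_rank] assms(3) by blast
  then show thesis
    using that subspace_rank_strict_mono[OF fd sub sub] by (metis linorder_not_less psubsetI)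
qed

lemma ex_maximal_subspace:
  assumes fd: "fin_dim" and sub: "\<And>W. P W \<Longrightarrow> subspace K W V" and "P X"
  obtains W where "P W" "\<And>Y. P Y \<Longrightarrow> W \<subseteq> Y \<Longrightarrow> Y = W"
proof -
  have "\<forall>Y. P Y \<longrightarrow> subspace_rank Y < Suc dim"
    using subspace_rank_le_dim[OF fd sub] by (simp add: less_Suc_eq_le)
  then obtain W where "P W" "\<And>Y. P Y \<Longrightarrow> subspace_rank Y \<le> subspace_rank W"
    using ex_has_greatest_nat[of P X subspace_rank "Suc dim"] assms(3) by blast
  then show thesis
    using that subspace_rank_strict_mono[OF fd sub sub] by (metis linorder_not_less psubsetI)
qed

lemma dim_eq_1_iff:
  assumes "fin_dim"
  shows "dim = 1 \<longleftrightarrow> (\<exists>x\<in>carrier V. x \<noteq> \<zero>\<^bsub>V\<^esub> \<and> span {x} = carrier V)"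
proof
  assume d: "dim = 1"
  obtain B where B: "finite B" "basis B" using finite_basis_exists[OF assms] by blast
  then have "card B = 1" using dim_basis d by metis
  then obtain x where x: "B = {x}" using card_1_singletonE by blast
  have "x \<noteq> \<zero>\<^bsub>V\<^esub>" using B(2) vs_zero_lin_dep unfolding basis_def x by blast
  then show "\<exists>x\<in>carrier V. x \<noteq> \<zero>\<^bsub>V\<^esub> \<and> span {x} = carrier V"
    using B(2) unfolding basis_def x by blast
qed (use dim1I in blast)

text \<open>Restricting the carrier does not change spans, so the dimension of the restricted
  structure can be read off from a generating vector in \<open>V\<close>.\<close>

lemma dim_subspace_eq_1_iff:
  assumes fd: "fin_dim" and W: "subspace K W V"
  shows "vectorspace.dim K (vs W) = 1 \<longleftrightarrow> (\<exists>x\<in>W. x \<noteq> \<zero>\<^bsub>V\<^esub> \<and> span {x} = W)"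
proof -
  interpret W: vectorspace K "vs W" by (rule subspace_is_vs[OF W])
  have span_eq: "W.span S = span S" if "S \<subseteq> W" for S
    by (rule span_li_not_depend(1)[OF that is_module[OF W]])
  obtain B where "finite B" "B \<subseteq> W" "span B = W" by (rule ex_subspace_basis[OF fd W])
  then have "W.fin_dim" unfolding W.fin_dim_def using span_eq by (intro exI[of _ B]) simp
  from W.dim_eq_1_iff[OF this] show ?thesis using span_eq by simp
qed

end

section \<open>Ideals and solvability\<close>

context lie_algebra
begin

declare lie_closed [simp, intro]

lemma lie_zero [simp]:
  assumes "x \<in> carrier L"
  shows "\<lblot>\<zero>\<^bsub>L\<^esub>, x\<rblot>\<^bsub>L\<^esub> = \<zero>\<^bsub>L\<^esub>" "\<lblot>x, \<zero>\<^bsub>L\<^esub>\<rblot>\<^bsub>L\<^esub> = \<zero>\<^bsub>L\<^esub>"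
  using lie_smult_left[of "\<zero>\<^bsub>F\<^esub>" x x] lie_smult_right[of "\<zero>\<^bsub>F\<^esub>" x x] assms
  by (simp_all add: lie_alternating)

lemma lie_skew:
  assumes "x \<in> carrier L" "y \<in> carrier L"
  shows "\<lblot>x, y\<rblot>\<^bsub>L\<^esub> = \<ominus>\<^bsub>L\<^esub> \<lblot>y, x\<rblot>\<^bsub>L\<^esub>"
proof -
  have "\<zero>\<^bsub>L\<^esub> = \<lblot>x \<oplus>\<^bsub>L\<^esub> y, x \<oplus>\<^bsub>L\<^esub> y\<rblot>\<^bsub>L\<^esub>"
    using assms by (intro lie_alternating[symmetric]) simp
  also have "\<dots> = \<lblot>x, y\<rblot>\<^bsub>L\<^esub> \<oplus>\<^bsub>L\<^esub> \<lblot>y, x\<rblot>\<^bsub>L\<^esub>"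
    using assms by (subst lie_add_left) (simp_all add: lie_add_right lie_alternating)
  finally show ?thesis
    using assms by (simp add: M.minus_equality)
qed

lemma lie_neg_right:
  assumes "x \<in> carrier L" "y \<in> carrier L"
  shows "\<lblot>x, \<ominus>\<^bsub>L\<^esub> y\<rblot>\<^bsub>L\<^esub> = \<ominus>\<^bsub>L\<^esub> \<lblot>x, y\<rblot>\<^bsub>L\<^esub>"
  using lie_smult_right[of "\<ominus>\<^bsub>F\<^esub> \<one>\<^bsub>F\<^esub>" x y] assms by (simp add: smult_minus_1)

lemma lie_neg_left:
  assumes "x \<in> carrier L" "y \<in> carrier L"
  shows "\<lblot>\<ominus>\<^bsub>L\<^esub> x, y\<rblot>\<^bsub>L\<^esub> = \<ominus>\<^bsub>L\<^esub> \<lblot>x, y\<rblot>\<^bsub>L\<^esub>"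
  using lie_smult_left[of "\<ominus>\<^bsub>F\<^esub> \<one>\<^bsub>F\<^esub>" x y] assms by (simp add: smult_minus_1)

text \<open>The Jacobi identity solved for its first term: \<open>ad x\<close> is a
  derivation.\<close>

lemma lie_leibniz:
  assumes "x \<in> carrier L" "y \<in> carrier L" "z \<in> carrier L"
  shows "\<lblot>x, \<lblot>y, z\<rblot>\<^bsub>L\<^esub>\<rblot>\<^bsub>L\<^esub> = \<lblot>\<lblot>x, y\<rblot>\<^bsub>L\<^esub>, z\<rblot>\<^bsub>L\<^esub> \<oplus>\<^bsub>L\<^esub> \<lblot>y, \<lblot>x, z\<rblot>\<^bsub>L\<^esub>\<rblot>\<^bsub>L\<^esub>"
proof -
  have 1: "\<lblot>y, \<lblot>z, x\<rblot>\<^bsub>L\<^esub>\<rblot>\<^bsub>L\<^esub> = \<ominus>\<^bsub>L\<^esub> \<lblot>y, \<lblot>x, z\<rblot>\<^bsub>L\<^esub>\<rblot>\<^bsub>L\<^esub>"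
    using assms lie_skew[of z x] by (simp add: lie_neg_right)
  have 2: "\<lblot>z, \<lblot>x, y\<rblot>\<^bsub>L\<^esub>\<rblot>\<^bsub>L\<^esub> = \<ominus>\<^bsub>L\<^esub> \<lblot>\<lblot>x, y\<rblot>\<^bsub>L\<^esub>, z\<rblot>\<^bsub>L\<^esub>"
    using assms lie_skew[of z "\<lblot>x, y\<rblot>\<^bsub>L\<^esub>"] by simp
  have "\<lblot>x, \<lblot>y, z\<rblot>\<^bsub>L\<^esub>\<rblot>\<^bsub>L\<^esub> \<ominus>\<^bsub>L\<^esub> (\<lblot>\<lblot>x, y\<rblot>\<^bsub>L\<^esub>, z\<rblot>\<^bsub>L\<^esub> \<oplus>\<^bsub>L\<^esub> \<lblot>y, \<lblot>x, z\<rblot>\<^bsub>L\<^esub>\<rblot>\<^bsub>L\<^esub>) = \<zero>\<^bsub>L\<^esub>"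
    using lie_jacobi[OF assms] assms unfolding 1 2
    by (simp add: a_minus_def M.minus_add M.a_ac)
  then show ?thesis using assms by simp
qed

text \<open>It reduces invariance of a span under \<open>ad x\<close> to its generators: a subspace
  of this form that contains the generators contains their span.\<close>

lemma subspace_lie_vimage:
  assumes "subspace F W L" "x \<in> carrier L"
  shows "subspace F {y \<in> carrier L. \<lblot>x, y\<rblot>\<^bsub>L\<^esub> \<in> W} L"
  using assms subspaceD[OF assms(1)]
  by (auto intro!: subspaceI simp: lie_add_right lie_smult_right)

lemma lie_right_mem_iff:
  assumes "subspace F W L" "x \<in> carrier L" "y \<in> carrier L"
  shows "\<lblot>x, y\<rblot>\<^bsub>L\<^esub> \<in> W \<longleftrightarrow> \<lblot>y, x\<rblot>\<^bsub>L\<^esub> \<in> W"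
  using subspace_neg_iff[OF assms(1), of "\<lblot>y, x\<rblot>\<^bsub>L\<^esub>"] lie_skew[OF assms(2,3)] assms by simp

lemma lie_idealI:
  assumes "subspace F I L" "\<And>x y. x \<in> carrier L \<Longrightarrow> y \<in> I \<Longrightarrow> \<lblot>x, y\<rblot>\<^bsub>L\<^esub> \<in> I"
  shows "lie_ideal F L I"
  using assms by (simp add: lie_ideal_def)

lemma lie_ideal_subspace: "lie_ideal F L I \<Longrightarrow> subspace F I L"
  by (simp add: lie_ideal_def)

lemma lie_idealD:
  assumes "lie_ideal F L I"
  shows "I \<subseteq> carrier L" "x \<in> I \<Longrightarrow> x \<in> carrier L" "\<zero>\<^bsub>L\<^esub> \<in> I"
    "x \<in> carrier L \<Longrightarrow> y \<in> I \<Longrightarrow> \<lblot>x, y\<rblot>\<^bsub>L\<^esub> \<in> I"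
    "x \<in> carrier L \<Longrightarrow> y \<in> I \<Longrightarrow> \<lblot>y, x\<rblot>\<^bsub>L\<^esub> \<in> I"
  using assms subspaceD[OF lie_ideal_subspace[OF assms]]
    lie_right_mem_iff[OF lie_ideal_subspace[OF assms], of x y]
  by (auto simp: lie_ideal_def)

lemma lie_subalgebraI:
  assumes "subspace F S L" "\<And>x y. x \<in> S \<Longrightarrow> y \<in> S \<Longrightarrow> \<lblot>x, y\<rblot>\<^bsub>L\<^esub> \<in> S"
  shows "lie_subalgebra F L S"
  using assms by (simp add: lie_subalgebra_def)

lemma lie_subalgebra_subspace: "lie_subalgebra F L S \<Longrightarrow> subspace F S L"
  by (simp add: lie_subalgebra_def)

lemma lie_subalgebra_lie: "lie_subalgebra F L S \<Longrightarrow> x \<in> S \<Longrightarrow> y \<in> S \<Longrightarrow> \<lblot>x, y\<rblot>\<^bsub>L\<^esub> \<in> S"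
  by (simp add: lie_subalgebra_def)

lemma lie_ideal_imp_subalgebra: "lie_ideal F L I \<Longrightarrow> lie_subalgebra F L I"
  by (meson lie_idealD(2,4) lie_ideal_subspace lie_subalgebraI)

lemma lie_ideal_carrier: "lie_ideal F L (carrier L)"
  by (rule lie_idealI) (auto intro: subspace_carrier)

lemma lie_ideal_zero: "lie_ideal F L {\<zero>\<^bsub>L\<^esub>}"
  by (rule lie_idealI) (auto intro: subspace_zero)

lemma lie_ideal_Int: "lie_ideal F L A \<Longrightarrow> lie_ideal F L B \<Longrightarrow> lie_ideal F L (A \<inter> B)"
  by (auto simp: lie_ideal_def subspace_Int)

lemma lie_subalgebra_set_add:
  assumes I: "lie_ideal F L I" and S: "lie_subalgebra F L S"
  shows "lie_subalgebra F L (I <+>\<^bsub>L\<^esub> S)"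
proof (rule lie_subalgebraI)
  note sI = lie_ideal_subspace[OF I] and sS = lie_subalgebra_subspace[OF S]
  show "subspace F (I <+>\<^bsub>L\<^esub> S) L" by (rule subspace_set_add[OF sI sS])
  fix x y assume "x \<in> I <+>\<^bsub>L\<^esub> S" "y \<in> I <+>\<^bsub>L\<^esub> S"
  then obtain a s b t where *: "a \<in> I" "s \<in> S" "b \<in> I" "t \<in> S" "x = a \<oplus>\<^bsub>L\<^esub> s" "y = b \<oplus>\<^bsub>L\<^esub> t"
    by (auto simp: mem_set_add)
  note c = lie_idealD(2)[OF I *(1)] lie_idealD(2)[OF I *(3)] subspaceD(2)[OF sS *(2)] subspaceD(2)[OF sS *(4)]
  \<comment> \<open>All terms with a factor in the ideal are collected on the left; only
    \<open>[s, t]\<close> remains, which \<open>S\<close> absorbs.\<close>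
  have "\<lblot>x, y\<rblot>\<^bsub>L\<^esub> = (\<lblot>a, b \<oplus>\<^bsub>L\<^esub> t\<rblot>\<^bsub>L\<^esub> \<oplus>\<^bsub>L\<^esub> \<lblot>s, b\<rblot>\<^bsub>L\<^esub>) \<oplus>\<^bsub>L\<^esub> \<lblot>s, t\<rblot>\<^bsub>L\<^esub>"
    using * c by (simp add: lie_add_left lie_add_right M.a_ac)
  moreover have "\<lblot>a, b \<oplus>\<^bsub>L\<^esub> t\<rblot>\<^bsub>L\<^esub> \<oplus>\<^bsub>L\<^esub> \<lblot>s, b\<rblot>\<^bsub>L\<^esub> \<in> I"
    using * c by (intro subspaceD(4)[OF sI] lie_idealD(4,5)[OF I]) auto
  moreover have "\<lblot>s, t\<rblot>\<^bsub>L\<^esub> \<in> S" using * lie_subalgebra_lie[OF S] by blast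
  ultimately show "\<lblot>x, y\<rblot>\<^bsub>L\<^esub> \<in> I <+>\<^bsub>L\<^esub> S" unfolding mem_set_add by blast
qed

lemma lie_ideal_set_add:
  assumes "lie_ideal F L A" "lie_ideal F L B"
  shows "lie_ideal F L (A <+>\<^bsub>L\<^esub> B)"
proof (rule lie_idealI)
  show "subspace F (A <+>\<^bsub>L\<^esub> B) L" using assms lie_ideal_subspace subspace_set_add by blast
  fix x y assume "x \<in> carrier L" "y \<in> A <+>\<^bsub>L\<^esub> B"
  then obtain a b where *: "a \<in> A" "b \<in> B" "y = a \<oplus>\<^bsub>L\<^esub> b" by (auto simp: mem_set_add)
  have "\<lblot>x, y\<rblot>\<^bsub>L\<^esub> = \<lblot>x, a\<rblot>\<^bsub>L\<^esub> \<oplus>\<^bsub>L\<^esub> \<lblot>x, b\<rblot>\<^bsub>L\<^esub>"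
    using * \<open>x \<in> carrier L\<close> lie_idealD(2)[OF assms(1)] lie_idealD(2)[OF assms(2)]
    by (simp add: lie_add_right)
  moreover have "\<lblot>x, a\<rblot>\<^bsub>L\<^esub> \<in> A" "\<lblot>x, b\<rblot>\<^bsub>L\<^esub> \<in> B"
    using * \<open>x \<in> carrier L\<close> assms lie_idealD(4) by blast+
  ultimately show "\<lblot>x, y\<rblot>\<^bsub>L\<^esub> \<in> A <+>\<^bsub>L\<^esub> B" unfolding mem_set_add by blast
qed

lemma lie_subalgebra_span_singleton:
  assumes "x \<in> carrier L" shows "lie_subalgebra F L (span {x})"
proof (rule lie_subalgebraI)
  show s: "subspace F (span {x}) L" using assms by (simp add: span_is_subspace)
  fix a b assume "a \<in> span {x}" "b \<in> span {x}"
  then have "\<lblot>a, b\<rblot>\<^bsub>L\<^esub> = \<zero>\<^bsub>L\<^esub>"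
    using assms by (auto simp: mem_span_singleton lie_smult_left lie_smult_right lie_alternating)
  then show "\<lblot>a, b\<rblot>\<^bsub>L\<^esub> \<in> span {x}" using subspaceD(3)[OF s] by simp
qed

section \<open>Products of ideals and the series built from them\<close>

lemma lie_product_carrier:
  assumes "A \<subseteq> carrier L" "B \<subseteq> carrier L"
  shows "{\<lblot>x, y\<rblot>\<^bsub>L\<^esub> | x y. x \<in> A \<and> y \<in> B} \<subseteq> carrier L"
  using assms by blast

lemma subspace_lie_product:
  assumes "A \<subseteq> carrier L" "B \<subseteq> carrier L"
  shows "subspace F (lie_product F L A B) L"
  unfolding lie_product_def by (rule span_is_subspace[OF lie_product_carrier[OF assms]])

lemma lie_product_subset_iff:
  assumes "A \<subseteq> carrier L" "B \<subseteq> carrier L" "subspace F W L"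
  shows "lie_product F L A B \<subseteq> W \<longleftrightarrow> (\<forall>x\<in>A. \<forall>y\<in>B. \<lblot>x, y\<rblot>\<^bsub>L\<^esub> \<in> W)"
  unfolding lie_product_def span_subset_iff[OF assms(3) lie_product_carrier[OF assms(1,2)]]
  by blast

lemma lie_mem_product:
  assumes "A \<subseteq> carrier L" "B \<subseteq> carrier L" "x \<in> A" "y \<in> B"
  shows "\<lblot>x, y\<rblot>\<^bsub>L\<^esub> \<in> lie_product F L A B"
  using lie_product_subset_iff[OF assms(1,2) subspace_lie_product[OF assms(1,2)]] assms(3,4) by blast

text \<open>By the derivation rule, \<open>ad x\<close> sends a generating bracket to a sum of two
  generating brackets, and the span inherits this.\<close>

lemma lie_ideal_product:
  assumes A: "lie_ideal F L A" and B: "lie_ideal F L B"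
  shows "lie_ideal F L (lie_product F L A B)"
proof (rule lie_idealI)
  note c = lie_idealD(1)[OF A] lie_idealD(1)[OF B]
  show s: "subspace F (lie_product F L A B) L" by (rule subspace_lie_product[OF c])
  fix x y assume x: "x \<in> carrier L" and y: "y \<in> lie_product F L A B"
  have "\<lblot>x, \<lblot>a, b\<rblot>\<^bsub>L\<^esub>\<rblot>\<^bsub>L\<^esub> \<in> lie_product F L A B" if "a \<in> A" "b \<in> B" for a b
  proof -
    have "\<lblot>\<lblot>x, a\<rblot>\<^bsub>L\<^esub>, b\<rblot>\<^bsub>L\<^esub> \<in> lie_product F L A B" "\<lblot>a, \<lblot>x, b\<rblot>\<^bsub>L\<^esub>\<rblot>\<^bsub>L\<^esub> \<in> lie_product F L A B"
      using that x lie_idealD(4)[OF A] lie_idealD(4)[OF B] lie_mem_product[OF c] by blast+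
    then show ?thesis
      using that x c subspaceD(4)[OF s] lie_leibniz[of x a b] by (metis in_mono)
  qed
  then have "lie_product F L A B \<subseteq> {y \<in> carrier L. \<lblot>x, y\<rblot>\<^bsub>L\<^esub> \<in> lie_product F L A B}"
    using c by (subst lie_product_subset_iff[OF c subspace_lie_vimage[OF s x]]) auto
  then show "\<lblot>x, y\<rblot>\<^bsub>L\<^esub> \<in> lie_product F L A B" using y by blast
qed

lemma lie_ideal_derived_series: "lie_ideal F L (derived_series F L k)"
  by (induction k) (simp_all add: lie_ideal_carrier lie_ideal_product)

lemma lie_ideal_lower_central_series:
  "lie_ideal F L I \<Longrightarrow> lie_ideal F L (lower_central_series F L I k)"
  by (induction k) (simp_all add: lie_ideal_product)

text \<open>A perfect section \<open>A = [A, A] + K\<close> would lie in every term of the derived series modulo \<open>K\<close>.\<close>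

lemma solvable_section_not_perfect:
  assumes sol: "lie_solvable F L" and A: "lie_ideal F L A" and K: "lie_ideal F L K"
    and perfect: "A \<subseteq> lie_product F L A A <+>\<^bsub>L\<^esub> K"
  shows "A \<subseteq> K"
proof -
  note sK = lie_ideal_subspace[OF K]
  have *: "A \<subseteq> derived_series F L k <+>\<^bsub>L\<^esub> K" for k
  proof (induction k)
    case 0
    then show ?case
      using set_add_upper(1)[OF subspace_carrier sK] lie_idealD(1)[OF A] by simp
  next
    case (Suc k)
    let ?D = "derived_series F L k"
    note D = lie_ideal_derived_series[of k] and D' = lie_ideal_derived_series[of "Suc k"]
    have cD: "?D \<subseteq> carrier L" using lie_idealD(1)[OF D] .
    note sD' = lie_ideal_subspace[OF D']
    have s: "subspace F (derived_series F L (Suc k) <+>\<^bsub>L\<^esub> K) L"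
      by (rule subspace_set_add[OF sD' sK])
    have "\<lblot>x, y\<rblot>\<^bsub>L\<^esub> \<in> derived_series F L (Suc k) <+>\<^bsub>L\<^esub> K" if "x \<in> A" "y \<in> A" for x y
    proof -
      from that Suc obtain d k1 e k2 where *: "d \<in> ?D" "k1 \<in> K" "x = d \<oplus>\<^bsub>L\<^esub> k1"
        "e \<in> ?D" "k2 \<in> K" "y = e \<oplus>\<^bsub>L\<^esub> k2" unfolding subset_iff mem_set_add by meson
      have c: "d \<in> carrier L" "e \<in> carrier L" "k1 \<in> carrier L" "k2 \<in> carrier L"
        using * cD lie_idealD(1)[OF K] by blast+
      \<comment> \<open>Modulo \<open>K\<close> only \<open>[d, e]\<close> survives, as every other
        term has a factor in \<open>K\<close>; this is one step down the derived series.\<close>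
      have "\<lblot>x, y\<rblot>\<^bsub>L\<^esub> = \<lblot>d, e\<rblot>\<^bsub>L\<^esub> \<oplus>\<^bsub>L\<^esub> (\<lblot>d, k2\<rblot>\<^bsub>L\<^esub> \<oplus>\<^bsub>L\<^esub> \<lblot>k1, e \<oplus>\<^bsub>L\<^esub> k2\<rblot>\<^bsub>L\<^esub>)"
        using * c by (simp add: lie_add_left lie_add_right M.a_ac)
      moreover have "\<lblot>d, k2\<rblot>\<^bsub>L\<^esub> \<oplus>\<^bsub>L\<^esub> \<lblot>k1, e \<oplus>\<^bsub>L\<^esub> k2\<rblot>\<^bsub>L\<^esub> \<in> K"
        using * c by (intro subspaceD(4)[OF sK] lie_idealD(4,5)[OF K]) auto
      moreover have "\<lblot>d, e\<rblot>\<^bsub>L\<^esub> \<in> derived_series F L (Suc k)"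
        using * cD by (simp add: lie_mem_product)
      ultimately show ?thesis unfolding mem_set_add by blast
    qed
    then have "lie_product F L A A \<subseteq> derived_series F L (Suc k) <+>\<^bsub>L\<^esub> K"
      using lie_product_subset_iff[OF _ _ s] lie_idealD(1)[OF A] by blast
    moreover have "K \<subseteq> derived_series F L (Suc k) <+>\<^bsub>L\<^esub> K"
      by (rule set_add_upper(2)[OF sD' sK])
    ultimately have "lie_product F L A A <+>\<^bsub>L\<^esub> K \<subseteq> derived_series F L (Suc k) <+>\<^bsub>L\<^esub> K"
      by (rule set_add_least[OF s])
    with perfect show ?case by blast
  qed
  obtain k where "derived_series F L k = {\<zero>\<^bsub>L\<^esub>}" using sol unfolding lie_solvable_def by blast
  with *[of k] have "A \<subseteq> {\<zero>\<^bsub>L\<^esub>} <+>\<^bsub>L\<^esub> K" by simp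
  also have "\<dots> \<subseteq> K" using subspaceD(3)[OF sK] by (intro set_add_least[OF sK]) auto
  finally show ?thesis .
qed

text \<open>\<open>[A, A] + K\<close> is an ideal between \<open>K\<close> and \<open>A\<close>.
  Minimality leaves two values for it, and the value \<open>A\<close> would make the section
  perfect.\<close>

lemma solvable_minimal_section_abelian:
  assumes sol: "lie_solvable F L" and A: "lie_ideal F L A" and K: "lie_ideal F L K"
    and KA: "K \<subset> A" and min: "\<And>J. lie_ideal F L J \<Longrightarrow> K \<subseteq> J \<Longrightarrow> J \<subseteq> A \<Longrightarrow> J = K \<or> J = A"
    and "x \<in> A" "y \<in> A"
  shows "\<lblot>x, y\<rblot>\<^bsub>L\<^esub> \<in> K"
proof -
  let ?P = "lie_product F L A A"
  note cA = lie_idealD(1)[OF A] and sK = lie_ideal_subspace[OF K]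
  have P: "lie_ideal F L ?P" by (rule lie_ideal_product[OF A A])
  have up: "K \<subseteq> ?P <+>\<^bsub>L\<^esub> K" "?P \<subseteq> ?P <+>\<^bsub>L\<^esub> K"
    using set_add_upper[OF lie_ideal_subspace[OF P] sK] by blast+
  have "?P \<subseteq> A" using lie_product_subset_iff[OF cA cA lie_ideal_subspace[OF A]] lie_idealD[OF A] by blast
  then have "?P <+>\<^bsub>L\<^esub> K \<subseteq> A" using KA by (intro set_add_least lie_ideal_subspace[OF A]) auto
  then have "?P <+>\<^bsub>L\<^esub> K = K \<or> ?P <+>\<^bsub>L\<^esub> K = A"
    by (intro min lie_ideal_set_add P K up)
  moreover have "?P <+>\<^bsub>L\<^esub> K \<noteq> A"
    using solvable_section_not_perfect[OF sol A K] KA by blast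
  ultimately have "?P \<subseteq> K" using up(2) by simp
  then show ?thesis using lie_mem_product[OF cA cA] assms(6,7) by blast
qed

end

section \<open>Quotients\<close>

locale lie_algebra_ideal = lie_algebra F L for F :: "('a, 'm) ring_scheme" and L :: "('a, 'b) lie_struct" +
  fixes I :: "'b set"
  assumes ideal: "lie_ideal F L I"
begin

abbreviation Q :: "('a, 'b set) lie_struct" where "Q \<equiv> lie_quotient L I"
abbreviation \<pi> :: "'b \<Rightarrow> 'b set" where "\<pi> x \<equiv> I +>\<^bsub>L\<^esub> x"

lemmas I_subspace = lie_ideal_subspace[OF ideal]

sublocale abelian_subgroup I L
proof (rule abelian_subgroupI3)
  have "inv\<^bsub>add_monoid L\<^esub> a \<in> I" if "a \<in> I" for a
    using subspace_neg[OF I_subspace that] by (simp add: a_inv_def)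
  then have "subgroup I (add_monoid L)"
    using subspaceD[OF I_subspace] by (intro subgroup.intro) auto
  then show "additive_subgroup I L" by (rule additive_subgroupI)
qed (rule M.abelian_group_axioms)

lemma \<pi>_self: "x \<in> carrier L \<Longrightarrow> x \<in> \<pi> x"
  by (rule a_rcos_self)

lemma mem_\<pi>_iff: "x \<in> carrier L \<Longrightarrow> y \<in> carrier L \<Longrightarrow> y \<in> \<pi> x \<longleftrightarrow> y \<ominus>\<^bsub>L\<^esub> x \<in> I"
proof
  assume c: "x \<in> carrier L" "y \<in> carrier L"
  { assume "y \<in> \<pi> x"
    then obtain h where h: "h \<in> I" "y = h \<oplus>\<^bsub>L\<^esub> x" by (auto simp: a_r_coset_def')
    then have "y \<ominus>\<^bsub>L\<^esub> x = h"
      using c lie_idealD(2)[OF ideal h(1)] by (simp add: a_minus_def M.a_assoc M.r_neg)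
    then show "y \<ominus>\<^bsub>L\<^esub> x \<in> I" using h by simp }
  { assume "y \<ominus>\<^bsub>L\<^esub> x \<in> I"
    moreover have "y = (y \<ominus>\<^bsub>L\<^esub> x) \<oplus>\<^bsub>L\<^esub> x"
      using c by (simp add: a_minus_def M.a_assoc M.l_neg)
    ultimately show "y \<in> \<pi> x" unfolding a_r_coset_def' by blast }
qed

lemma \<pi>_subset: "x \<in> carrier L \<Longrightarrow> \<pi> x \<subseteq> carrier L"
  by (intro M.a_r_coset_subset_G lie_idealD(1)[OF ideal])

lemma \<pi>_eq_iff:
  assumes "x \<in> carrier L" "y \<in> carrier L"
  shows "\<pi> x = \<pi> y \<longleftrightarrow> x \<ominus>\<^bsub>L\<^esub> y \<in> I"
  using assms mem_\<pi>_iff[of y x] \<pi>_self[of x] M.a_repr_independence[of x I y] a_subgroup by metis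

lemma carrier_Q: "carrier Q = \<pi> ` carrier L"
  by (auto simp: lie_quotient_def A_RCOSETS_def')

lemma \<pi>_closed [simp, intro]: "x \<in> carrier L \<Longrightarrow> \<pi> x \<in> carrier Q"
  by (auto simp: carrier_Q)

lemma zero_Q: "\<zero>\<^bsub>Q\<^esub> = \<pi> \<zero>\<^bsub>L\<^esub>"
  by (simp add: lie_quotient_def lie_idealD(1)[OF ideal])

lemma \<pi>_zero_iff: "x \<in> carrier L \<Longrightarrow> \<pi> x = \<zero>\<^bsub>Q\<^esub> \<longleftrightarrow> x \<in> I"
  unfolding zero_Q
  by (simp add: \<pi>_eq_iff subspace_minus_cancel(1)[OF I_subspace _ lie_idealD(3)[OF ideal]])

lemma \<pi>_add: "x \<in> carrier L \<Longrightarrow> y \<in> carrier L \<Longrightarrow> \<pi> x \<oplus>\<^bsub>Q\<^esub> \<pi> y = \<pi> (x \<oplus>\<^bsub>L\<^esub> y)"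
  by (simp add: lie_quotient_def a_rcos_sum)

lemma \<pi>_smult:
  assumes "c \<in> carrier F" "x \<in> carrier L"
  shows "c \<odot>\<^bsub>Q\<^esub> \<pi> x = \<pi> (c \<odot>\<^bsub>L\<^esub> x)"
proof -
  have "\<pi> (c \<odot>\<^bsub>L\<^esub> y) = \<pi> (c \<odot>\<^bsub>L\<^esub> x)" if "y \<in> \<pi> x" for y
  proof -
    have y: "y \<in> carrier L" using that \<pi>_subset assms by blast
    then have "c \<odot>\<^bsub>L\<^esub> (y \<ominus>\<^bsub>L\<^esub> x) \<in> I"
      using that assms mem_\<pi>_iff subspaceD(5)[OF I_subspace] by blast
    then show ?thesis
      using assms y by (simp add: \<pi>_eq_iff a_minus_def smult_r_distr smult_r_minus)
  qed
  then have "(\<Union>y\<in>\<pi> x. \<pi> (c \<odot>\<^bsub>L\<^esub> y)) = \<pi> (c \<odot>\<^bsub>L\<^esub> x)"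
    using \<pi>_self[OF assms(2)] by blast
  then show ?thesis by (simp add: lie_quotient_def)
qed

text \<open>The union that defines the quotient bracket runs over equal cosets, because
  \<open>[u, v] - [x, y] = [u, v - y] + [u - x, y]\<close> lies in the ideal.\<close>

lemma \<pi>_lie:
  assumes "x \<in> carrier L" "y \<in> carrier L"
  shows "\<lblot>\<pi> x, \<pi> y\<rblot>\<^bsub>Q\<^esub> = \<pi> \<lblot>x, y\<rblot>\<^bsub>L\<^esub>"
proof -
  have "\<pi> \<lblot>u, v\<rblot>\<^bsub>L\<^esub> = \<pi> \<lblot>x, y\<rblot>\<^bsub>L\<^esub>" if "u \<in> \<pi> x" "v \<in> \<pi> y" for u v
  proof -
    have c: "u \<in> carrier L" "v \<in> carrier L" using that \<pi>_subset assms by blast+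
    then have m: "u \<ominus>\<^bsub>L\<^esub> x \<in> I" "v \<ominus>\<^bsub>L\<^esub> y \<in> I" using that assms mem_\<pi>_iff by blast+
    have "\<lblot>u, v\<rblot>\<^bsub>L\<^esub> \<ominus>\<^bsub>L\<^esub> \<lblot>x, y\<rblot>\<^bsub>L\<^esub> = \<lblot>u, v \<ominus>\<^bsub>L\<^esub> y\<rblot>\<^bsub>L\<^esub> \<oplus>\<^bsub>L\<^esub> \<lblot>u \<ominus>\<^bsub>L\<^esub> x, y\<rblot>\<^bsub>L\<^esub>"
      using c assms
      by (simp add: lie_add_left lie_add_right lie_neg_left lie_neg_right a_minus_def
          M.a_assoc M.r_neg2 M.r_neg1)
    also have "\<dots> \<in> I"
      using m c assms by (intro subspaceD(4)[OF I_subspace] lie_idealD(4,5)[OF ideal])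
    finally show ?thesis using c assms by (simp add: \<pi>_eq_iff)
  qed
  then have "(\<Union>u\<in>\<pi> x. \<Union>v\<in>\<pi> y. \<pi> \<lblot>u, v\<rblot>\<^bsub>L\<^esub>) = \<pi> \<lblot>x, y\<rblot>\<^bsub>L\<^esub>"
    using \<pi>_self[OF assms(1)] \<pi>_self[OF assms(2)] by blast
  then show ?thesis by (simp add: lie_quotient_def)
qed

lemma carrier_QE:
  assumes "X \<in> carrier Q" obtains x where "x \<in> carrier L" "X = \<pi> x"
  using assms unfolding carrier_Q by blast

lemma vectorspace_Q: "vectorspace F Q"
proof (rule vs_criteria)
  show "\<forall>v\<in>carrier Q. \<exists>neg_v\<in>carrier Q. v \<oplus>\<^bsub>Q\<^esub> neg_v = \<zero>\<^bsub>Q\<^esub>"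
  proof
    fix v assume "v \<in> carrier Q"
    then obtain x where x: "x \<in> carrier L" "v = \<pi> x" by (rule carrier_QE)
    then have "v \<oplus>\<^bsub>Q\<^esub> \<pi> (\<ominus>\<^bsub>L\<^esub> x) = \<zero>\<^bsub>Q\<^esub>" "\<pi> (\<ominus>\<^bsub>L\<^esub> x) \<in> carrier Q"
      by (simp_all add: \<pi>_add M.r_neg zero_Q)
    then show "\<exists>neg_v\<in>carrier Q. v \<oplus>\<^bsub>Q\<^esub> neg_v = \<zero>\<^bsub>Q\<^esub>" by blast
  qed
next
  show "\<forall>v w. v \<in> carrier Q \<and> w \<in> carrier Q \<longrightarrow> v \<oplus>\<^bsub>Q\<^esub> w = w \<oplus>\<^bsub>Q\<^esub> v"
    by (auto elim!: carrier_QE simp: \<pi>_add M.a_comm)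
next
  show "\<forall>v w x. v \<in> carrier Q \<and> w \<in> carrier Q \<and> x \<in> carrier Q \<longrightarrow>
      (v \<oplus>\<^bsub>Q\<^esub> w) \<oplus>\<^bsub>Q\<^esub> x = v \<oplus>\<^bsub>Q\<^esub> (w \<oplus>\<^bsub>Q\<^esub> x)"
    by (auto elim!: carrier_QE simp: \<pi>_add M.a_assoc)
qed (auto elim!: carrier_QE simp: zero_Q \<pi>_add \<pi>_smult smult_l_distr smult_r_distr smult_assoc1
    intro: field_axioms)

sublocale Q: lie_algebra F Q
proof (intro lie_algebra.intro vectorspace_Q lie_algebra_axioms.intro)
qed (auto elim!: carrier_QE simp: zero_Q \<pi>_add \<pi>_smult \<pi>_lie lie_add_left lie_add_right
    lie_smult_left lie_smult_right lie_alternating lie_jacobi)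

lemma linear_map_\<pi>: "linear_map F L Q \<pi>"
  unfolding linear_map_def mod_hom_def mod_hom_axioms_def module_hom_def
  using vectorspace_axioms vectorspace_Q module_axioms Q.module_axioms
  by (auto simp: \<pi>_add \<pi>_smult)

lemma fin_dim_Q: "fin_dim \<Longrightarrow> Q.fin_dim"
  using linear_map.surj_fin_dim[OF linear_map_\<pi>] carrier_Q by blast

section \<open>Correspondence between the quotient and the part of \<open>L\<close> above the
  ideal\<close>

definition lift :: "'b set set \<Rightarrow> 'b set" where
  "lift X = {x \<in> carrier L. \<pi> x \<in> X}"

lemma lift_carrier: "lift (carrier Q) = carrier L"
  by (auto simp: lift_def)

lemma subspace_image:
  assumes "subspace F W L" shows "subspace F (\<pi> ` W) Q"
proof (rule Q.subspaceI)
  note D = subspaceD[OF assms]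
  show "\<pi> ` W \<subseteq> carrier Q" using D(1) by blast
  show "\<zero>\<^bsub>Q\<^esub> \<in> \<pi> ` W" using D(3) by (simp add: zero_Q)
  show "x \<oplus>\<^bsub>Q\<^esub> y \<in> \<pi> ` W" if xy: "x \<in> \<pi> ` W" "y \<in> \<pi> ` W" for x y
  proof -
    obtain u v where uv: "u \<in> W" "v \<in> W" "x = \<pi> u" "y = \<pi> v" using xy by blast
    then have "x \<oplus>\<^bsub>Q\<^esub> y = \<pi> (u \<oplus>\<^bsub>L\<^esub> v)" using D(2) by (simp add: \<pi>_add)
    then show ?thesis using D(4) uv by blast
  qed
  show "c \<odot>\<^bsub>Q\<^esub> x \<in> \<pi> ` W" if cx: "c \<in> carrier F" "x \<in> \<pi> ` W" for c x
  proof -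
    obtain u where u: "u \<in> W" "x = \<pi> u" using cx by blast
    then have "c \<odot>\<^bsub>Q\<^esub> x = \<pi> (c \<odot>\<^bsub>L\<^esub> u)" using cx D(2) by (simp add: \<pi>_smult)
    then show ?thesis using D(5) u cx by blast
  qed
qed

lemma subspace_lift:
  assumes "subspace F X Q" shows "subspace F (lift X) L"
  using Q.subspaceD[OF assms]
  by (auto intro!: subspaceI simp: lift_def zero_Q simp flip: \<pi>_add \<pi>_smult)

lemma I_subset_lift:
  assumes "subspace F X Q" shows "I \<subseteq> lift X"
proof
  fix x assume "x \<in> I"
  moreover from this have "x \<in> carrier L" using lie_idealD(2)[OF ideal] by blast
  ultimately show "x \<in> lift X"
    using Q.subspaceD(3)[OF assms] \<pi>_zero_iff[of x] by (simp add: lift_def)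
qed

lemma image_lift: "X \<subseteq> carrier Q \<Longrightarrow> \<pi> ` lift X = X"
  by (auto simp: lift_def carrier_Q)

text \<open>A subspace above \<open>I\<close> is a union of cosets, so membership does not depend on
  the representative. Hence \<open>lift\<close> inverts the image map on such subspaces, which is
  the correspondence theorem in the form needed here.\<close>

lemma \<pi>_mem_image_iff:
  assumes "subspace F W L" "I \<subseteq> W" "x \<in> carrier L"
  shows "\<pi> x \<in> \<pi> ` W \<longleftrightarrow> x \<in> W"
proof
  assume "\<pi> x \<in> \<pi> ` W"
  then obtain w where w: "w \<in> W" "\<pi> x = \<pi> w" by blast
  then have wc: "w \<in> carrier L" using subspaceD(2)[OF assms(1)] by blast
  then have "x \<ominus>\<^bsub>L\<^esub> w \<in> W" using w assms \<pi>_eq_iff by blast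
  then show "x \<in> W" using subspace_minus_cancel(1)[OF assms(1,3) w(1)] by simp
qed simp

lemma lift_image: "subspace F W L \<Longrightarrow> I \<subseteq> W \<Longrightarrow> lift (\<pi> ` W) = W"
  using \<pi>_mem_image_iff subspaceD(2) by (auto simp: lift_def)

lemma image_zero_iff:
  assumes "subspace F W L"
  shows "\<pi> ` W = {\<zero>\<^bsub>Q\<^esub>} \<longleftrightarrow> W \<subseteq> I"
proof -
  have "\<zero>\<^bsub>Q\<^esub> \<in> \<pi> ` W" using Q.subspaceD(3)[OF subspace_image[OF assms]] .
  then have "\<pi> ` W = {\<zero>\<^bsub>Q\<^esub>} \<longleftrightarrow> (\<forall>w\<in>W. \<pi> w = \<zero>\<^bsub>Q\<^esub>)" by blast
  also have "\<dots> \<longleftrightarrow> W \<subseteq> I" using \<pi>_zero_iff subspaceD(2)[OF assms] by blast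
  finally show ?thesis .
qed

lemma image_I: "\<pi> ` I = {\<zero>\<^bsub>Q\<^esub>}"
  using image_zero_iff[OF I_subspace] by simp

lemma image_eq_iff:
  assumes "subspace F A L" "I \<subseteq> A" "subspace F B L" "I \<subseteq> B"
  shows "\<pi> ` A = \<pi> ` B \<longleftrightarrow> A = B"
  using lift_image assms by metis

lemma set_add_image:
  assumes "A \<subseteq> carrier L" "B \<subseteq> carrier L"
  shows "\<pi> ` A <+>\<^bsub>Q\<^esub> \<pi> ` B = \<pi> ` (A <+>\<^bsub>L\<^esub> B)"
proof -
  have "\<pi> a \<oplus>\<^bsub>Q\<^esub> \<pi> b = \<pi> (a \<oplus>\<^bsub>L\<^esub> b)" if "a \<in> A" "b \<in> B" for a b
    using that assms by (intro \<pi>_add) auto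
  then show ?thesis by (fastforce simp: set_add_def')
qed

lemma span_singleton_image:
  assumes "x \<in> carrier L"
  shows "\<pi> ` span {x} = Q.span {\<pi> x}"
proof -
  have "y \<in> \<pi> ` span {x} \<longleftrightarrow> y \<in> Q.span {\<pi> x}" for y
    using assms mem_span_singleton[OF assms] Q.mem_span_singleton[of "\<pi> x"] by (auto simp: \<pi>_smult)
  then show ?thesis by blast
qed

lemma lie_ideal_image:
  assumes "lie_ideal F L A" shows "lie_ideal F Q (\<pi> ` A)"
  using lie_idealD(2,4)[OF assms]
  by (auto intro!: Q.lie_idealI subspace_image[OF lie_ideal_subspace[OF assms]] elim!: carrier_QE simp: \<pi>_lie)

lemma lie_ideal_lift:
  assumes "lie_ideal F Q X" shows "lie_ideal F L (lift X)"
  using Q.lie_idealD(4)[OF assms]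
  by (intro lie_idealI subspace_lift[OF Q.lie_ideal_subspace[OF assms]])
    (auto simp: lift_def simp flip: \<pi>_lie)

lemma lie_subalgebra_image:
  assumes "lie_subalgebra F L A" shows "lie_subalgebra F Q (\<pi> ` A)"
  using lie_subalgebra_lie[OF assms] subspaceD(2)[OF lie_subalgebra_subspace[OF assms]]
  by (auto intro!: Q.lie_subalgebraI subspace_image[OF lie_subalgebra_subspace[OF assms]] simp: \<pi>_lie)

lemma lie_subalgebra_lift:
  assumes "lie_subalgebra F Q X" shows "lie_subalgebra F L (lift X)"
  using Q.lie_subalgebra_lie[OF assms]
  by (intro lie_subalgebraI subspace_lift[OF Q.lie_subalgebra_subspace[OF assms]])
    (auto simp: lift_def simp flip: \<pi>_lie)

lemma maximal_subalgebra_image: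
  assumes M: "maximal_subalgebra F L M" and "I \<subseteq> M"
  shows "maximal_subalgebra F Q (\<pi> ` M)"
proof -
  have sM: "lie_subalgebra F L M" and MS: "subspace F M L"
    using M lie_subalgebra_subspace by (auto simp: maximal_subalgebra_def)
  have "\<pi> ` M \<noteq> carrier Q"
    using M image_eq_iff[OF MS \<open>I \<subseteq> M\<close> subspace_carrier lie_idealD(1)[OF ideal]]
    by (simp add: carrier_Q maximal_subalgebra_def)
  moreover have "S = \<pi> ` M \<or> S = carrier Q" if S: "lie_subalgebra F Q S" "\<pi> ` M \<subseteq> S" for S
  proof -
    have "M \<subseteq> lift S" using S(2) subspaceD(2)[OF MS] by (auto simp: lift_def)
    then have "lift S = M \<or> lift S = carrier L"
      using M lie_subalgebra_lift[OF S(1)] by (auto simp: maximal_subalgebra_def)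
    then show ?thesis
      using image_lift Q.subspaceD(1)[OF Q.lie_subalgebra_subspace[OF S(1)]] carrier_Q by metis
  qed
  ultimately show ?thesis
    using lie_subalgebra_image[OF sM] by (simp add: maximal_subalgebra_def)
qed

lemma maximal_subalgebra_lift:
  assumes X: "maximal_subalgebra F Q X"
  shows "maximal_subalgebra F L (lift X)"
proof -
  have sX: "lie_subalgebra F Q X" and XS: "subspace F X Q"
    using X Q.lie_subalgebra_subspace by (auto simp: maximal_subalgebra_def)
  note c = Q.subspaceD(1)[OF XS]
  have "lift X \<noteq> carrier L"
    using X image_lift[OF c] carrier_Q by (auto simp: maximal_subalgebra_def)
  moreover have "S = lift X \<or> S = carrier L" if S: "lie_subalgebra F L S" "lift X \<subseteq> S" for S
  proof -
    have "X \<subseteq> \<pi> ` S" using S(2) image_lift[OF c] by blast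
    then have "\<pi> ` S = X \<or> \<pi> ` S = carrier Q"
      using X lie_subalgebra_image[OF S(1)] by (auto simp: maximal_subalgebra_def)
    moreover have "lift (\<pi> ` S) = S"
      using S I_subset_lift[OF XS] by (intro lift_image lie_subalgebra_subspace) auto
    ultimately show ?thesis using lift_carrier by auto
  qed
  ultimately show ?thesis
    using lie_subalgebra_lift[OF sX] by (simp add: maximal_subalgebra_def)
qed

text \<open>Image and \<open>lift\<close> match the maximal subalgebras of the quotient with those
  of \<open>L\<close> above \<open>I\<close>. Intersecting with the carrier covers the case that
  there are none.\<close>

lemma lift_frattini:
  "lift (frattini F Q) = carrier L \<inter> \<Inter>{M. maximal_subalgebra F L M \<and> I \<subseteq> M}"
proof (intro equalityI subsetI)
  fix x assume x: "x \<in> lift (frattini F Q)"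
  have "x \<in> M" if M: "maximal_subalgebra F L M" "I \<subseteq> M" for M
  proof -
    have "\<pi> x \<in> \<pi> ` M"
      using x maximal_subalgebra_image[OF M] by (auto simp: lift_def frattini_def)
    moreover have "subspace F M L"
      using M lie_subalgebra_subspace by (simp add: maximal_subalgebra_def)
    ultimately show ?thesis using \<pi>_mem_image_iff M x by (auto simp: lift_def)
  qed
  then show "x \<in> carrier L \<inter> \<Inter>{M. maximal_subalgebra F L M \<and> I \<subseteq> M}"
    using x by (auto simp: lift_def)
next
  fix x assume x: "x \<in> carrier L \<inter> \<Inter>{M. maximal_subalgebra F L M \<and> I \<subseteq> M}"
  have "\<pi> x \<in> X" if X: "maximal_subalgebra F Q X" for X
  proof -
    have "subspace F X Q"
      using X Q.lie_subalgebra_subspace by (simp add: maximal_subalgebra_def)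
    then have "x \<in> lift X"
      using maximal_subalgebra_lift[OF X] I_subset_lift x by blast
    then show ?thesis by (simp add: lift_def)
  qed
  then show "x \<in> lift (frattini F Q)"
    using x by (auto simp: lift_def frattini_def)
qed

text \<open>Under the correspondence of ideals, minimality in the quotient means that no ideal of
  \<open>L\<close> lies strictly between \<open>I\<close> and \<open>A\<close>. Later minimality
  arguments use this form and stay inside \<open>L\<close>.\<close>

lemma minimal_ideal_image_iff:
  assumes A: "lie_ideal F L A" and "I \<subseteq> A"
  shows "minimal_ideal F Q (\<pi> ` A) \<longleftrightarrow>
    A \<noteq> I \<and> (\<forall>J. lie_ideal F L J \<longrightarrow> I \<subseteq> J \<longrightarrow> J \<subseteq> A \<longrightarrow> J = I \<or> J = A)"
proof -
  note sA = lie_ideal_subspace[OF A]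
  have 1: "\<pi> ` A \<noteq> {\<zero>\<^bsub>Q\<^esub>} \<longleftrightarrow> A \<noteq> I"
    using image_eq_iff[OF sA \<open>I \<subseteq> A\<close> I_subspace] by (simp add: image_I)
  have 2: "(\<forall>X. lie_ideal F Q X \<and> X \<subseteq> \<pi> ` A \<longrightarrow> X = {\<zero>\<^bsub>Q\<^esub>} \<or> X = \<pi> ` A) \<longleftrightarrow>
    (\<forall>J. lie_ideal F L J \<longrightarrow> I \<subseteq> J \<longrightarrow> J \<subseteq> A \<longrightarrow> J = I \<or> J = A)" (is "?l = ?r")
  proof
    assume l: ?l
    show ?r
    proof (intro allI impI)
      fix J assume J: "lie_ideal F L J" "I \<subseteq> J" "J \<subseteq> A"
      then have "\<pi> ` J = \<pi> ` I \<or> \<pi> ` J = \<pi> ` A"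
        using l[rule_format, of "\<pi> ` J"] lie_ideal_image[OF J(1)] image_mono[OF J(3), of \<pi>]
        by (simp add: image_I)
      then show "J = I \<or> J = A"
        using image_eq_iff[OF lie_ideal_subspace[OF J(1)] J(2) sA \<open>I \<subseteq> A\<close>]
          image_eq_iff[OF lie_ideal_subspace[OF J(1)] J(2) I_subspace] by simp
    qed
  next
    assume r: ?r
    show ?l
    proof (intro allI impI)
      fix X assume X: "lie_ideal F Q X \<and> X \<subseteq> \<pi> ` A"
      then have iX: "lie_ideal F Q X" by blast
      have "lift X \<subseteq> lift (\<pi> ` A)" using X by (auto simp: lift_def)
      then have "lift X \<subseteq> A" using lift_image[OF sA \<open>I \<subseteq> A\<close>] by simp
      then have "lift X = I \<or> lift X = A"
        using r lie_ideal_lift[OF iX] I_subset_lift[OF Q.lie_ideal_subspace[OF iX]] by simp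
      then have "\<pi> ` lift X = \<pi> ` I \<or> \<pi> ` lift X = \<pi> ` A" by blast
      moreover have "\<pi> ` lift X = X"
        by (rule image_lift[OF Q.lie_idealD(1)[OF iX]])
      ultimately show "X = {\<zero>\<^bsub>Q\<^esub>} \<or> X = \<pi> ` A"
        by (simp add: image_I)
    qed
  qed
  show ?thesis unfolding minimal_ideal_def 1 2 using lie_ideal_image[OF A] by simp
qed

text \<open>Both inclusions are checked on generating brackets, the second one after pulling the
  target back to \<open>L\<close> by \<open>lift\<close>.\<close>

lemma lie_product_image:
  assumes "A \<subseteq> carrier L" "B \<subseteq> carrier L"
  shows "lie_product F Q (\<pi> ` A) (\<pi> ` B) = \<pi> ` lie_product F L A B"
proof
  have c: "\<pi> ` A \<subseteq> carrier Q" "\<pi> ` B \<subseteq> carrier Q" using assms by blast+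
  have "\<lblot>\<pi> x, \<pi> y\<rblot>\<^bsub>Q\<^esub> \<in> \<pi> ` lie_product F L A B" if "x \<in> A" "y \<in> B" for x y
  proof -
    have "x \<in> carrier L" "y \<in> carrier L" using that assms by blast+
    then show ?thesis using lie_mem_product[OF assms that] by (simp add: \<pi>_lie)
  qed
  then show "lie_product F Q (\<pi> ` A) (\<pi> ` B) \<subseteq> \<pi> ` lie_product F L A B"
    by (subst Q.lie_product_subset_iff[OF c subspace_image[OF subspace_lie_product[OF assms]]]) blast
  have "\<lblot>x, y\<rblot>\<^bsub>L\<^esub> \<in> lift (lie_product F Q (\<pi> ` A) (\<pi> ` B))" if "x \<in> A" "y \<in> B" for x y
  proof -
    have xy: "x \<in> carrier L" "y \<in> carrier L" using that assms by blast+
    have "\<lblot>\<pi> x, \<pi> y\<rblot>\<^bsub>Q\<^esub> \<in> lie_product F Q (\<pi> ` A) (\<pi> ` B)"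
      using that by (intro Q.lie_mem_product[OF c]) auto
    then show ?thesis using xy by (simp add: lift_def \<pi>_lie)
  qed
  then have "lie_product F L A B \<subseteq> lift (lie_product F Q (\<pi> ` A) (\<pi> ` B))"
    by (subst lie_product_subset_iff[OF assms subspace_lift[OF Q.subspace_lie_product[OF c]]]) blast
  then show "\<pi> ` lie_product F L A B \<subseteq> lie_product F Q (\<pi> ` A) (\<pi> ` B)"
    by (auto simp: lift_def)
qed

lemma lower_central_series_image:
  assumes A: "lie_ideal F L A"
  shows "lower_central_series F Q (\<pi> ` A) k = \<pi> ` lower_central_series F L A k"
  by (induction k) (simp_all add: lie_product_image lie_idealD(1) A lie_ideal_lower_central_series)

text \<open>The projection commutes with the lower central series, and a subspace has zero image
  exactly when it lies in \<open>I\<close>.\<close>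

lemma lie_nilpotent_image_iff:
  assumes A: "lie_ideal F L A"
  shows "lie_nilpotent F Q (\<pi> ` A) \<longleftrightarrow> (\<exists>k. lower_central_series F L A k \<subseteq> I)"
proof -
  have "\<pi> ` lower_central_series F L A k = {\<zero>\<^bsub>Q\<^esub>} \<longleftrightarrow> lower_central_series F L A k \<subseteq> I" for k
    by (intro image_zero_iff lie_ideal_subspace lie_ideal_lower_central_series A)
  then show ?thesis
    unfolding lie_nilpotent_def lower_central_series_image[OF A] by simp
qed

end

context lie_algebra
begin

lemma chief_factor_iff:
  "chief_factor F L A B \<longleftrightarrow> lie_ideal F L A \<and> lie_ideal F L B \<and> B \<subset> A \<and>
    (\<forall>J. lie_ideal F L J \<longrightarrow> B \<subseteq> J \<longrightarrow> J \<subseteq> A \<longrightarrow> J = B \<or> J = A)"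
proof (cases "lie_ideal F L A \<and> lie_ideal F L B \<and> B \<subseteq> A")
  case True
  interpret B: lie_algebra_ideal F L B
    using True by unfold_locales blast
  show ?thesis
    using True B.minimal_ideal_image_iff[of A] unfolding chief_factor_def quotient_image_def by blast
qed (auto simp: chief_factor_def)

end

section \<open>Nilpotent ideals and the nilradical\<close>

context lie_algebra
begin

lemma lower_central_series_Suc_subset:
  assumes "lie_ideal F L A"
  shows "lower_central_series F L A (Suc k) \<subseteq> lower_central_series F L A k"
proof -
  note I = lie_ideal_lower_central_series[OF assms, of k]
  show ?thesis
    using lie_product_subset_iff[OF lie_idealD(1)[OF assms] lie_idealD(1)[OF I] lie_ideal_subspace[OF I]]
      lie_idealD(4)[OF I] lie_idealD(2)[OF assms] by simp
qed

lemma lie_lower_central_series_Suc: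
  assumes "lie_ideal F L A" "x \<in> A" "y \<in> lower_central_series F L A k"
  shows "\<lblot>x, y\<rblot>\<^bsub>L\<^esub> \<in> lower_central_series F L A (Suc k)"
  using lie_mem_product[OF lie_idealD(1) lie_idealD(1), of A "lower_central_series F L A k" x y]
    lie_ideal_lower_central_series assms by simp

text \<open>By induction the filtration dominates the lower central series term by term. Its terms
  are only required to be subspaces, which leaves room for kernels of operators.\<close>

lemma lie_nilpotentI:
  assumes A: "lie_ideal F L A" and Z: "\<And>k. subspace F (Z k) L" and "A \<subseteq> Z 0"
    and step: "\<And>k a z. a \<in> A \<Longrightarrow> z \<in> Z k \<Longrightarrow> \<lblot>a, z\<rblot>\<^bsub>L\<^esub> \<in> Z (Suc k)" and end0: "Z n = {\<zero>\<^bsub>L\<^esub>}"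
  shows "lie_nilpotent F L A"
proof -
  have "lower_central_series F L A k \<subseteq> Z k" for k
  proof (induction k)
    case (Suc k)
    have "lie_product F L A (lower_central_series F L A k) \<subseteq> Z (Suc k)"
      using Suc step lie_idealD(1)[OF lie_ideal_lower_central_series[OF A]]
      by (subst lie_product_subset_iff[OF lie_idealD(1)[OF A] _ Z]) blast+
    then show ?case by simp
  qed (simp add: assms)
  then have "lower_central_series F L A n = {\<zero>\<^bsub>L\<^esub>}"
    using end0 lie_idealD(3)[OF lie_ideal_lower_central_series[OF A], of n] by blast
  then show ?thesis unfolding lie_nilpotent_def by blast
qed

text \<open>
  Refining each step \<open>P j \<supseteq> P (j + 1)\<close> of the series of \<open>N\<close> by the filtration \<open>Y\<close> gives a series for \<open>B\<close>.
\<close>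

lemma lie_nilpotent_extension:
  assumes N: "lie_ideal F L N" "lie_nilpotent F L N" and B: "lie_ideal F L B" "B \<subseteq> N <+>\<^bsub>L\<^esub> S"
    and S: "S \<subseteq> carrier L" and Y: "\<And>i. subspace F (Y i) L" "Y 0 = carrier L" "Y (Suc m) = {\<zero>\<^bsub>L\<^esub>}"
    and step: "\<And>i s y. s \<in> S \<Longrightarrow> y \<in> Y i \<Longrightarrow> \<lblot>s, y\<rblot>\<^bsub>L\<^esub> \<in> Y (Suc i)"
  shows "lie_nilpotent F L B"
proof -
  \<comment> \<open>The whole algebra is put in front of the lower central series of
    \<open>N\<close>, so that the refined series can start with all of \<open>L\<close>. The step
    condition persists because \<open>N\<close> is an ideal.\<close>
  define P where "P = case_nat (carrier L) (lower_central_series F L N)"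
  have P_ideal: "lie_ideal F L (P j)" for j
    by (cases j) (simp_all add: P_def lie_ideal_carrier lie_ideal_lower_central_series N)
  have P_step: "\<lblot>x, p\<rblot>\<^bsub>L\<^esub> \<in> P (Suc j)" if "x \<in> N" "p \<in> P j" for x p j
    using that lie_idealD(5)[OF N(1)] lie_lower_central_series_Suc[OF N(1)]
    by (cases j) (auto simp: P_def)
  have P_mono: "P (Suc j) \<subseteq> P j" for j
    using lower_central_series_Suc_subset[OF N(1)] lie_idealD(1)[OF N(1)]
    by (cases j) (simp_all add: P_def)
  obtain l where "lower_central_series F L N l = {\<zero>\<^bsub>L\<^esub>}" using N(2) unfolding lie_nilpotent_def by blast
  then obtain n where n: "P n = {\<zero>\<^bsub>L\<^esub>}" by (intro that[of "Suc l"]) (simp add: P_def)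
  note PD = lie_idealD[OF P_ideal] and Ps = lie_ideal_subspace[OF P_ideal]
  \<comment> \<open>For fixed \<open>j\<close> these subspaces interpolate between
    \<open>P j\<close> and \<open>P (Suc j)\<close>: they are the layers of \<open>Y\<close> on
    \<open>P j\<close>, taken modulo \<open>P (Suc j)\<close>.\<close>
  define G where "G i j = (Y i \<inter> P j) <+>\<^bsub>L\<^esub> P (Suc j)" for i j
  \<comment> \<open>Lexicographic enumeration of the pairs: each \<open>j\<close> gets a block of
    \<open>Suc m\<close> layers, so the block of \<open>n\<close>, where \<open>P\<close> vanishes,
    starts at \<open>n * Suc m\<close>.\<close>
  define Z where "Z k = G (k mod Suc m) (k div Suc m)" for k
  have G_sub: "subspace F (G i j) L" for i j
    unfolding G_def by (intro subspace_set_add subspace_Int Y Ps)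
  have G_up: "Y i \<inter> P j \<subseteq> G i j" "P (Suc j) \<subseteq> G i j" for i j
    unfolding G_def using set_add_upper[OF subspace_Int[OF Y(1) Ps] Ps] by blast+
  have G_step: "\<lblot>b, z\<rblot>\<^bsub>L\<^esub> \<in> G (Suc i) j" if bz: "b \<in> B" "z \<in> G i j" for b z i j
  proof -
    obtain x s where xs: "x \<in> N" "s \<in> S" "b = x \<oplus>\<^bsub>L\<^esub> s"
      using bz(1) B(2) unfolding subset_iff mem_set_add by blast
    obtain y p where yp: "y \<in> Y i" "y \<in> P j" "p \<in> P (Suc j)" "z = y \<oplus>\<^bsub>L\<^esub> p"
      using bz(2) unfolding G_def mem_set_add by blast
    have c: "x \<in> carrier L" "s \<in> carrier L" "y \<in> carrier L" "p \<in> carrier L"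
      using xs yp S PD(1) lie_idealD(1)[OF N(1)] by blast+
    \<comment> \<open>Only \<open>[s, y]\<close> needs the filtration \<open>Y\<close>, and it stays
      in \<open>P j\<close> since that is an ideal. Brackets with \<open>x\<close> drop by the
      series of \<open>N\<close>, and \<open>[s, p]\<close> is already in the lower term.\<close>
    have "\<lblot>b, z\<rblot>\<^bsub>L\<^esub> = \<lblot>s, y\<rblot>\<^bsub>L\<^esub> \<oplus>\<^bsub>L\<^esub> (\<lblot>x, y \<oplus>\<^bsub>L\<^esub> p\<rblot>\<^bsub>L\<^esub> \<oplus>\<^bsub>L\<^esub> \<lblot>s, p\<rblot>\<^bsub>L\<^esub>)"
      using xs yp c by (simp add: lie_add_left lie_add_right M.a_ac)
    moreover have "y \<oplus>\<^bsub>L\<^esub> p \<in> P j" using yp P_mono subspaceD(4)[OF Ps] by blast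
    then have "\<lblot>x, y \<oplus>\<^bsub>L\<^esub> p\<rblot>\<^bsub>L\<^esub> \<oplus>\<^bsub>L\<^esub> \<lblot>s, p\<rblot>\<^bsub>L\<^esub> \<in> P (Suc j)"
      using P_step[OF xs(1)] PD(4)[OF c(2) yp(3)] by (intro subspaceD(4)[OF Ps])
    moreover have "\<lblot>s, y\<rblot>\<^bsub>L\<^esub> \<in> Y (Suc i) \<inter> P j" using xs yp c step PD(4) by blast
    ultimately show ?thesis unfolding G_def mem_set_add by blast
  qed
  show ?thesis
  proof (rule lie_nilpotentI[OF B(1), of Z])
    show "subspace F (Z k) L" for k by (simp add: Z_def G_sub)
    show "B \<subseteq> Z 0" using G_up(1)[of 0 0] lie_idealD(1)[OF B(1)] by (simp add: Z_def Y(2) P_def)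
    show "Z (n * Suc m) = {\<zero>\<^bsub>L\<^esub>}"
    proof -
      have "Y 0 \<inter> P n = {\<zero>\<^bsub>L\<^esub>}" "P (Suc n) = {\<zero>\<^bsub>L\<^esub>}"
        using n P_mono[of n] PD(3)[of "Suc n"] by (simp_all add: Y(2), blast)
      then have "G 0 n = {\<zero>\<^bsub>L\<^esub>}" unfolding G_def by (simp add: set_add_def')
      moreover have "Z (n * Suc m) = G 0 n" by (simp add: Z_def del: mult_Suc_right)
      ultimately show ?thesis by simp
    qed
    fix k a z assume "a \<in> B" "z \<in> Z k"
    then have az: "\<lblot>a, z\<rblot>\<^bsub>L\<^esub> \<in> G (Suc (k mod Suc m)) (k div Suc m)" by (simp add: Z_def G_step)
    show "\<lblot>a, z\<rblot>\<^bsub>L\<^esub> \<in> Z (Suc k)"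
    proof (cases "Suc (k mod Suc m) = Suc m")
      case True
      \<comment> \<open>At the end of a block the carry to the next one is harmless:
        \<open>Y (Suc m)\<close> is zero, so the layer has shrunk to \<open>P (Suc j)\<close>, which
        the first layer of the next block contains.\<close>
      have "G (Suc m) j \<subseteq> P (Suc j)" for j
        unfolding G_def using PD(3) by (intro set_add_least Ps) (auto simp: Y(3))
      moreover have "P j \<subseteq> G 0 j" for j
        using G_up(1)[of 0 j] PD(1)[of j] by (simp add: Y(2) Int_absorb1)
      ultimately have "\<lblot>a, z\<rblot>\<^bsub>L\<^esub> \<in> G 0 (Suc (k div Suc m))"
        using az unfolding True by blast
      then show ?thesis using True by (simp add: Z_def mod_Suc div_Suc)
    next
      case False
      then show ?thesis using az by (simp add: Z_def mod_Suc div_Suc)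
    qed
  qed
qed

text \<open>The filtration lowered by \<open>J\<close> is \<open>L\<close> followed by the lower
  central series of \<open>J\<close>; its first step uses that \<open>J\<close> is an ideal.\<close>

lemma lie_nilpotent_set_add:
  assumes N: "lie_ideal F L N" "lie_nilpotent F L N" and J: "lie_ideal F L J" "lie_nilpotent F L J"
  shows "lie_nilpotent F L (N <+>\<^bsub>L\<^esub> J)"
proof -
  obtain m where m: "lower_central_series F L J m = {\<zero>\<^bsub>L\<^esub>}" using J(2) unfolding lie_nilpotent_def by blast
  define Y where "Y = case_nat (carrier L) (lower_central_series F L J)"
  show ?thesis
  proof (rule lie_nilpotent_extension[OF N lie_ideal_set_add[OF N(1) J(1)] subset_refl lie_idealD(1)[OF J(1)], of Y m])
    show "subspace F (Y i) L" for i
      by (cases i) (simp_all add: Y_def subspace_carrier lie_ideal_subspace lie_ideal_lower_central_series J)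
    show "\<lblot>s, y\<rblot>\<^bsub>L\<^esub> \<in> Y (Suc i)" if "s \<in> J" "y \<in> Y i" for i s y
      using that lie_idealD(5)[OF J(1)] lie_lower_central_series_Suc[OF J(1)]
      by (cases i) (auto simp: Y_def)
  qed (simp_all add: Y_def m)
qed

lemma lie_nilpotent_zero: "lie_nilpotent F L {\<zero>\<^bsub>L\<^esub>}"
  by (auto simp: lie_nilpotent_def intro: exI[of _ 0])

lemma lie_nilpotent_subset_nilradical:
  assumes "lie_ideal F L J" "lie_nilpotent F L J"
  shows "J \<subseteq> nilradical F L"
proof -
  have "\<Union>{I. lie_ideal F L I \<and> lie_nilpotent F L I} \<subseteq> carrier L" using lie_idealD(1) by blast
  from in_own_span[OF this] show ?thesis unfolding nilradical_def using assms by blast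
qed

text \<open>A maximal nilpotent ideal \<open>W\<close> absorbs every nilpotent ideal
  \<open>J\<close>, since \<open>W + J\<close> is again nilpotent. The union in the definition is
  then \<open>W\<close> itself, and the span adds nothing.\<close>

lemma nilradical_nilpotent_ideal:
  assumes "fin_dim"
  shows "lie_ideal F L (nilradical F L)" "lie_nilpotent F L (nilradical F L)"
proof -
  let ?P = "\<lambda>I. lie_ideal F L I \<and> lie_nilpotent F L I"
  obtain W where W: "?P W" and max: "\<And>Y. ?P Y \<Longrightarrow> W \<subseteq> Y \<Longrightarrow> Y = W"
    using ex_maximal_subspace[OF assms, of ?P] lie_ideal_zero lie_nilpotent_zero lie_ideal_subspace
    by (metis (no_types, lifting))
  have "J \<subseteq> W" if "?P J" for J
  proof -
    note up = set_add_upper[of W J, OF lie_ideal_subspace lie_ideal_subspace]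
    have "W <+>\<^bsub>L\<^esub> J = W"
      using W that up by (intro max) (auto intro: lie_ideal_set_add lie_nilpotent_set_add)
    then show ?thesis using up(2) W that by simp
  qed
  then have "\<Union>{I. ?P I} = W" using W by blast
  then have "nilradical F L = W"
    unfolding nilradical_def using W by (simp add: span_subspace lie_ideal_subspace)
  then show "lie_ideal F L (nilradical F L)" "lie_nilpotent F L (nilradical F L)" using W by simp_all
qed

section \<open>Powers of \<open>ad x\<close>, ad-nilpotent elements and Fitting's lemma\<close>

lemma ad_funpow_closed [simp, intro]:
  "x \<in> carrier L \<Longrightarrow> y \<in> carrier L \<Longrightarrow> (lie_bracket L x ^^ k) y \<in> carrier L"
  by (induction k) auto

lemma ad_funpow_add:
  "x \<in> carrier L \<Longrightarrow> y \<in> carrier L \<Longrightarrow> z \<in> carrier L \<Longrightarrow>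
    (lie_bracket L x ^^ k) (y \<oplus>\<^bsub>L\<^esub> z) = (lie_bracket L x ^^ k) y \<oplus>\<^bsub>L\<^esub> (lie_bracket L x ^^ k) z"
  by (induction k) (simp_all add: lie_add_right)

lemma ad_funpow_smult:
  "x \<in> carrier L \<Longrightarrow> y \<in> carrier L \<Longrightarrow> c \<in> carrier F \<Longrightarrow>
    (lie_bracket L x ^^ k) (c \<odot>\<^bsub>L\<^esub> y) = c \<odot>\<^bsub>L\<^esub> (lie_bracket L x ^^ k) y"
  by (induction k) (simp_all add: lie_smult_right)

lemma ad_funpow_zero [simp]: "x \<in> carrier L \<Longrightarrow> (lie_bracket L x ^^ k) \<zero>\<^bsub>L\<^esub> = \<zero>\<^bsub>L\<^esub>"
  by (induction k) simp_all

lemma ad_funpow_neg: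
  "x \<in> carrier L \<Longrightarrow> y \<in> carrier L \<Longrightarrow>
    (lie_bracket L x ^^ k) (\<ominus>\<^bsub>L\<^esub> y) = \<ominus>\<^bsub>L\<^esub> (lie_bracket L x ^^ k) y"
  by (induction k) (simp_all add: lie_neg_right)

lemma subspace_ad_kernel:
  "x \<in> carrier L \<Longrightarrow> subspace F {y \<in> carrier L. (lie_bracket L x ^^ k) y = \<zero>\<^bsub>L\<^esub>} L"
  by (rule subspaceI) (auto simp: ad_funpow_add ad_funpow_smult)

lemma subspace_ad_image:
  assumes x: "x \<in> carrier L" shows "subspace F ((lie_bracket L x ^^ k) ` carrier L) L"
proof (rule subspaceI)
  show "\<zero>\<^bsub>L\<^esub> \<in> (lie_bracket L x ^^ k) ` carrier L"
    using x by (intro image_eqI[of _ _ "\<zero>\<^bsub>L\<^esub>"]) auto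
qed (use x in \<open>auto simp flip: ad_funpow_add ad_funpow_smult\<close>)

text \<open>The kernels of the powers of \<open>ad x\<close>, listed by decreasing exponent, form
  the filtration that \<open>x\<close> lowers.\<close>

lemma lie_nilpotent_adjoin:
  assumes N: "lie_ideal F L N" "lie_nilpotent F L N" and x: "x \<in> carrier L"
    and nil: "\<And>y. y \<in> carrier L \<Longrightarrow> (lie_bracket L x ^^ m) y = \<zero>\<^bsub>L\<^esub>"
    and B: "lie_ideal F L (N <+>\<^bsub>L\<^esub> span {x})"
  shows "lie_nilpotent F L (N <+>\<^bsub>L\<^esub> span {x})"
\<comment> \<open>The exponent \<open>Suc m - i\<close> fits the required index range: at
  \<open>i = 0\<close> the kernel is everything, at \<open>i = Suc m\<close> the exponent is
  \<open>0\<close> and the kernel is zero.\<close>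
proof (rule lie_nilpotent_extension[OF N B subset_refl, of "\<lambda>i. {y \<in> carrier L. (lie_bracket L x ^^ (Suc m - i)) y = \<zero>\<^bsub>L\<^esub>}" m])
  show "span {x} \<subseteq> carrier L" using x by (intro span_is_subset2) simp
  show "subspace F {y \<in> carrier L. (lie_bracket L x ^^ (Suc m - i)) y = \<zero>\<^bsub>L\<^esub>} L" for i
    by (rule subspace_ad_kernel[OF x])
  show "{y \<in> carrier L. (lie_bracket L x ^^ (Suc m - 0)) y = \<zero>\<^bsub>L\<^esub>} = carrier L"
    using nil x by auto
  fix i s y assume s: "s \<in> span {x}" and y: "y \<in> {y \<in> carrier L. (lie_bracket L x ^^ (Suc m - i)) y = \<zero>\<^bsub>L\<^esub>}"
  obtain c where c: "c \<in> carrier F" "s = c \<odot>\<^bsub>L\<^esub> x" using s mem_span_singleton[OF x] by blast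
  have "(lie_bracket L x ^^ (Suc m - Suc i)) \<lblot>x, y\<rblot>\<^bsub>L\<^esub> = \<zero>\<^bsub>L\<^esub>"
  proof (cases "i \<le> m")
    case True
    then have "Suc m - i = Suc (m - i)" by simp
    then show ?thesis using y by (simp add: funpow_swap1)
  next
    \<comment> \<open>Here subtraction truncates: the exponent \<open>Suc m - i\<close> is already
      \<open>0\<close>, so \<open>y\<close> is zero.\<close>
    case False
    then show ?thesis using y x by simp
  qed
  then show "\<lblot>s, y\<rblot>\<^bsub>L\<^esub> \<in> {y \<in> carrier L. (lie_bracket L x ^^ (Suc m - Suc i)) y = \<zero>\<^bsub>L\<^esub>}"
    using c x y by (simp add: lie_smult_left ad_funpow_smult)
qed auto

text \<open>This is what the binomial Leibniz formula says about vanishing, without its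
  coefficients: each application of \<open>ad x\<close> uses up one of the \<open>i\<close> or one
  of the \<open>j\<close> steps, and a factor whose count has reached \<open>0\<close> is
  zero.\<close>

lemma ad_funpow_lie_eq_zero:
  assumes x: "x \<in> carrier L"
  shows "a \<in> carrier L \<Longrightarrow> b \<in> carrier L \<Longrightarrow> (lie_bracket L x ^^ i) a = \<zero>\<^bsub>L\<^esub> \<Longrightarrow>
    (lie_bracket L x ^^ j) b = \<zero>\<^bsub>L\<^esub> \<Longrightarrow> i + j \<le> n \<Longrightarrow> (lie_bracket L x ^^ n) \<lblot>a, b\<rblot>\<^bsub>L\<^esub> = \<zero>\<^bsub>L\<^esub>"
proof (induction n arbitrary: i j a b)
  case (Suc n)
  show ?case
  proof (cases "i = 0 \<or> j = 0")
    case True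
    then have "\<lblot>a, b\<rblot>\<^bsub>L\<^esub> = \<zero>\<^bsub>L\<^esub>" using Suc.prems by auto
    then show ?thesis using x by (metis ad_funpow_zero)
  next
    case False
    then obtain i' j' where ij: "i = Suc i'" "j = Suc j'" by (metis not0_implies_Suc)
    have "(lie_bracket L x ^^ n) \<lblot>\<lblot>x, a\<rblot>\<^bsub>L\<^esub>, b\<rblot>\<^bsub>L\<^esub> = \<zero>\<^bsub>L\<^esub>"
      using Suc.prems ij x by (intro Suc.IH[of _ _ i' j]) (auto simp: funpow_swap1)
    moreover have "(lie_bracket L x ^^ n) \<lblot>a, \<lblot>x, b\<rblot>\<^bsub>L\<^esub>\<rblot>\<^bsub>L\<^esub> = \<zero>\<^bsub>L\<^esub>"
      using Suc.prems ij x by (intro Suc.IH[of _ _ i j']) (auto simp: funpow_swap1)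
    moreover have "(lie_bracket L x ^^ Suc n) \<lblot>a, b\<rblot>\<^bsub>L\<^esub> =
        (lie_bracket L x ^^ n) (\<lblot>\<lblot>x, a\<rblot>\<^bsub>L\<^esub>, b\<rblot>\<^bsub>L\<^esub> \<oplus>\<^bsub>L\<^esub> \<lblot>a, \<lblot>x, b\<rblot>\<^bsub>L\<^esub>\<rblot>\<^bsub>L\<^esub>)"
      using Suc.prems x lie_leibniz[of x a b] by (simp add: funpow_swap1)
    ultimately show ?thesis
      using x Suc.prems by (simp add: ad_funpow_add del: funpow.simps)
  qed
qed auto

lemma ex_maximal_subalgebra:
  assumes "fin_dim" "lie_subalgebra F L S" "S \<noteq> carrier L"
  obtains M where "maximal_subalgebra F L M" "S \<subseteq> M"
proof -
  let ?P = "\<lambda>W. lie_subalgebra F L W \<and> S \<subseteq> W \<and> W \<noteq> carrier L"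
  obtain M where "?P M" "\<And>Y. ?P Y \<Longrightarrow> M \<subseteq> Y \<Longrightarrow> Y = M"
    by (rule ex_maximal_subspace[OF assms(1), of ?P S])
      (use assms lie_subalgebra_subspace in auto)
  then show thesis
    by (intro that[of M]) (auto simp: maximal_subalgebra_def)
qed

text \<open>
  By Fitting's lemma \<open>L\<close> is the sum of the null component of \<open>ad x\<close>, which is a subalgebra, and of
  the image of a power of \<open>ad x\<close>, which lies in the Frattini subalgebra.
\<close>

lemma ad_nilpotent_if_image_in_frattini:
  assumes fd: "fin_dim" and x: "x \<in> carrier L"
    and im: "\<And>y. y \<in> carrier L \<Longrightarrow> \<lblot>x, y\<rblot>\<^bsub>L\<^esub> \<in> frattini F L"
  obtains m where "\<And>y. y \<in> carrier L \<Longrightarrow> (lie_bracket L x ^^ m) y = \<zero>\<^bsub>L\<^esub>"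
proof -
  define T where "T k = lie_bracket L x ^^ k" for k
  have T_add: "T (i + j) y = T i (T j y)" for i j y by (simp add: T_def funpow_add)
  define L0 where "L0 = {y \<in> carrier L. \<exists>k. T k y = \<zero>\<^bsub>L\<^esub>}"
  have T_mono: "T j y = \<zero>\<^bsub>L\<^esub>" if "T i y = \<zero>\<^bsub>L\<^esub>" "i \<le> j" for i j y
    using T_add[of "j - i" i y] that x by (simp add: T_def)
  have "lie_subalgebra F L L0"
  proof (intro lie_subalgebraI subspaceI)
    show "\<zero>\<^bsub>L\<^esub> \<in> L0" using x by (auto simp: L0_def T_def)
    show "a \<oplus>\<^bsub>L\<^esub> b \<in> L0" if ab: "a \<in> L0" "b \<in> L0" for a b
    proof -
      obtain i j where ij: "T i a = \<zero>\<^bsub>L\<^esub>" "T j b = \<zero>\<^bsub>L\<^esub>" using ab by (auto simp: L0_def)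
      have "T (max i j) a = \<zero>\<^bsub>L\<^esub>" "T (max i j) b = \<zero>\<^bsub>L\<^esub>" by (rule T_mono, fact ij, simp)+
      then have "T (max i j) (a \<oplus>\<^bsub>L\<^esub> b) = \<zero>\<^bsub>L\<^esub>"
        using that x by (simp add: T_def L0_def ad_funpow_add)
      then show ?thesis using that by (auto simp: L0_def)
    qed
    show "c \<odot>\<^bsub>L\<^esub> a \<in> L0" if ca: "c \<in> carrier F" "a \<in> L0" for c a
    proof -
      obtain i where "T i a = \<zero>\<^bsub>L\<^esub>" using ca by (auto simp: L0_def)
      then have "T i (c \<odot>\<^bsub>L\<^esub> a) = \<zero>\<^bsub>L\<^esub>"
        using that x by (simp add: L0_def T_def ad_funpow_smult)
      then show ?thesis using that by (auto simp: L0_def)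
    qed
    show "\<lblot>a, b\<rblot>\<^bsub>L\<^esub> \<in> L0" if ab: "a \<in> L0" "b \<in> L0" for a b
    proof -
      obtain i j where "T i a = \<zero>\<^bsub>L\<^esub>" "T j b = \<zero>\<^bsub>L\<^esub>" using ab by (auto simp: L0_def)
      then have "T (i + j) \<lblot>a, b\<rblot>\<^bsub>L\<^esub> = \<zero>\<^bsub>L\<^esub>"
        using that ad_funpow_lie_eq_zero[OF x, of a b i j "i + j"] by (simp add: L0_def T_def)
      then show ?thesis using that by (auto simp: L0_def)
    qed
  qed (auto simp: L0_def)
  have "L0 = carrier L"
  proof (rule ccontr)
    assume "L0 \<noteq> carrier L"
    with \<open>lie_subalgebra F L L0\<close> obtain M where M: "maximal_subalgebra F L M" "L0 \<subseteq> M"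
      using ex_maximal_subalgebra[OF fd] by blast
    then have sM: "subspace F M L" by (simp add: maximal_subalgebra_def lie_subalgebra_subspace)
    \<comment> \<open>Positive exponents are needed so that these images lie in
      \<open>[x, L]\<close>, hence in the Frattini subalgebra. A minimal image stands for the point
      where the descending images become stable.\<close>
    let ?P = "\<lambda>W. \<exists>k. W = T (Suc k) ` carrier L"
    obtain W where W: "?P W" and min: "\<And>Y. ?P Y \<Longrightarrow> Y \<subseteq> W \<Longrightarrow> Y = W"
      by (rule ex_minimal_subspace[OF fd, of ?P "T (Suc 0) ` carrier L"])
        (use subspace_ad_image[OF x] in \<open>auto simp: T_def simp del: funpow.simps\<close>)
    from W obtain k' where "W = T (Suc k') ` carrier L" by blast
    then obtain k where k: "W = T k ` carrier L" "k = Suc k'" by blast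
    have "T (k + k) ` carrier L = W"
    proof (rule min)
      show "\<exists>j. T (k + k) ` carrier L = T (Suc j) ` carrier L"
        by (rule exI[of _ "k + k'"]) (simp add: k(2))
      show "T (k + k) ` carrier L \<subseteq> W" using x by (auto simp: k(1) T_add) (auto simp: T_def)
    qed
    have "v \<in> M" if v: "v \<in> carrier L" for v
    proof -
      \<comment> \<open>Fitting's decomposition of \<open>v\<close>: stability gives
        \<open>w\<close> with \<open>T k v = T (2k) w\<close>, so \<open>v - T k w\<close> is killed
        by \<open>T k\<close>, while \<open>T k w\<close> lies in the Frattini subalgebra and so in
        \<open>M\<close>.\<close>
      have "T k v \<in> T (k + k) ` carrier L" using v \<open>T (k + k) ` carrier L = W\<close> k(1) by blast
      then obtain w where w: "w \<in> carrier L" "T k v = T k (T k w)" by (auto simp: T_add)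
      have Tw: "T k w \<in> carrier L" using w x by (simp add: T_def)
      have "T k (v \<ominus>\<^bsub>L\<^esub> T k w) = \<zero>\<^bsub>L\<^esub>"
        using w v Tw x unfolding T_def by (simp add: a_minus_def ad_funpow_add ad_funpow_neg M.r_neg)
      then have "v \<ominus>\<^bsub>L\<^esub> T k w \<in> M" using v Tw M(2) by (auto simp: L0_def)
      moreover have "T k w \<in> frattini F L" using w x by (simp add: T_def k(2) im)
      then have "T k w \<in> M" using M(1) by (auto simp: frattini_def)
      ultimately show ?thesis using subspace_minus_cancel(1)[OF sM v] by blast
    qed
    then show False using M subspaceD(1)[OF sM] by (auto simp: maximal_subalgebra_def)
  qed
  \<comment> \<open>So far the exponent depends on \<open>y\<close>. A maximal kernel among those of
    the powers yields one exponent for all of \<open>L\<close>.\<close>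
  let ?P = "\<lambda>W. \<exists>k. W = {y \<in> carrier L. T k y = \<zero>\<^bsub>L\<^esub>}"
  obtain W where W: "?P W" and max: "\<And>Y. ?P Y \<Longrightarrow> W \<subseteq> Y \<Longrightarrow> Y = W"
    by (rule ex_maximal_subspace[OF fd, of ?P "{y \<in> carrier L. T 0 y = \<zero>\<^bsub>L\<^esub>}"])
      (use subspace_ad_kernel[OF x] in \<open>auto simp only: T_def\<close>)
  from W obtain m where m: "W = {y \<in> carrier L. T m y = \<zero>\<^bsub>L\<^esub>}" by blast
  have *: "T m y = \<zero>\<^bsub>L\<^esub>" if y: "y \<in> carrier L" for y
  proof -
    obtain j where "T j y = \<zero>\<^bsub>L\<^esub>" using y \<open>L0 = carrier L\<close> by (auto simp: L0_def)
    then have "y \<in> {y \<in> carrier L. T (max j m) y = \<zero>\<^bsub>L\<^esub>}" using y T_mono by simp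
    moreover have "{y \<in> carrier L. T (max j m) y = \<zero>\<^bsub>L\<^esub>} = W"
      by (rule max) (auto simp: m intro: T_mono)
    ultimately show ?thesis using m by blast
  qed
  show thesis by (rule that[of m]) (use * in \<open>simp add: T_def\<close>)
qed

end

section \<open>The Frattini ideal\<close>

context lie_algebra
begin

text \<open>\<open>K\<close> is an ideal maximal among those inside \<open>M\<close>, and
  \<open>A\<close> is minimal above it. Then \<open>M\<close> complements \<open>A\<close> modulo
  \<open>K\<close>, and the centraliser of \<open>A/K\<close> in \<open>M\<close> is an ideal, so it
  collapses to \<open>K\<close>. Comparing \<open>M\<close> with its conjugates by elements of
  \<open>A\<close> forces the Frattini subalgebra into that centraliser.\<close>

lemma ideal_between_frattini_and_maximal:
  assumes fd: "fin_dim" and sol: "lie_solvable F L" and M: "maximal_subalgebra F L M"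
  obtains K where "lie_ideal F L K" "frattini F L \<subseteq> K" "K \<subseteq> M"
proof -
  have subM: "lie_subalgebra F L M" and neM: "M \<noteq> carrier L"
    and maxM: "\<And>S. lie_subalgebra F L S \<Longrightarrow> M \<subseteq> S \<Longrightarrow> S = M \<or> S = carrier L"
    using M by (auto simp: maximal_subalgebra_def)
  note sM = lie_subalgebra_subspace[OF subM]
  note cM = subspaceD(1)[OF sM]
  let ?P = "\<lambda>K. lie_ideal F L K \<and> K \<subseteq> M"
  obtain K where K: "lie_ideal F L K" "K \<subseteq> M" and maxK: "\<And>J. ?P J \<Longrightarrow> K \<subseteq> J \<Longrightarrow> J = K"
    by (rule ex_maximal_subspace[OF fd, of ?P "{\<zero>\<^bsub>L\<^esub>}"])
      (auto simp: lie_ideal_subspace lie_ideal_zero subspaceD(3)[OF sM])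
  note sK = lie_ideal_subspace[OF K(1)]
  let ?P' = "\<lambda>J. lie_ideal F L J \<and> K \<subset> J"
  obtain A where A: "lie_ideal F L A" "K \<subset> A" and minA: "\<And>J. ?P' J \<Longrightarrow> J \<subseteq> A \<Longrightarrow> J = A"
    by (rule ex_minimal_subspace[OF fd, of ?P' "carrier L"])
      (use K(2) neM cM in \<open>auto simp: lie_ideal_subspace lie_ideal_carrier\<close>)
  note sA = lie_ideal_subspace[OF A(1)] and cA = lie_idealD(1)[OF A(1)]
  have abel: "\<lblot>a, b\<rblot>\<^bsub>L\<^esub> \<in> K" if "a \<in> A" "b \<in> A" for a b
    by (rule solvable_minimal_section_abelian[OF sol A(1) K(1) A(2) _ that]) (use minA in blast)
  have AM: "\<not> A \<subseteq> M" using maxK[of A] A by blast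
  have sum: "A <+>\<^bsub>L\<^esub> M = carrier L"
    using maxM[OF lie_subalgebra_set_add[OF A(1) subM]] set_add_upper[OF sA sM] AM by blast
  have decomp: "\<exists>a\<in>A. \<exists>m\<in>M. y = a \<oplus>\<^bsub>L\<^esub> m" if "y \<in> carrier L" for y
    using that sum[symmetric] by (simp add: mem_set_add)
  \<comment> \<open>Since \<open>L = A + M\<close>, it suffices to bracket with \<open>M\<close>,
    which normalises the intersection, and with \<open>A\<close>, where the result falls into
    \<open>K\<close> because \<open>A/K\<close> is abelian. Maximality of \<open>K\<close> then
    identifies the intersection with \<open>K\<close>.\<close>
  have "lie_ideal F L (A \<inter> M)"
  proof (rule lie_idealI[OF subspace_Int[OF sA sM]])
    fix y z assume y: "y \<in> carrier L" and z: "z \<in> A \<inter> M"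
    obtain a m where am: "a \<in> A" "m \<in> M" "y = a \<oplus>\<^bsub>L\<^esub> m" using decomp[OF y] by blast
    have c: "a \<in> carrier L" "m \<in> carrier L" "z \<in> carrier L" using am z cA cM by blast+
    have "\<lblot>y, z\<rblot>\<^bsub>L\<^esub> = \<lblot>a, z\<rblot>\<^bsub>L\<^esub> \<oplus>\<^bsub>L\<^esub> \<lblot>m, z\<rblot>\<^bsub>L\<^esub>" using am c by (simp add: lie_add_left)
    moreover have "\<lblot>a, z\<rblot>\<^bsub>L\<^esub> \<in> A \<inter> M" using abel[of a z] am z K(2) A(2) by blast
    moreover have "\<lblot>m, z\<rblot>\<^bsub>L\<^esub> \<in> A \<inter> M"
      using am z lie_subalgebra_lie[OF subM] lie_idealD(4)[OF A(1) c(2)] by blast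
    ultimately show "\<lblot>y, z\<rblot>\<^bsub>L\<^esub> \<in> A \<inter> M" using subspaceD(4)[OF subspace_Int[OF sA sM]] by simp
  qed
  then have AM_K: "A \<inter> M = K" using maxK[of "A \<inter> M"] K(2) A(2) by blast
  \<comment> \<open>The centraliser of \<open>A/K\<close> in \<open>M\<close>. Bracketing it with
    \<open>A\<close> lands in \<open>K\<close>, and bracketing it with \<open>M\<close> stays inside
    by the derivation rule.\<close>
  define C where "C = {x \<in> M. \<forall>a\<in>A. \<lblot>x, a\<rblot>\<^bsub>L\<^esub> \<in> K}"
  have sC: "subspace F C L"
    using subspaceD[OF sM] subspaceD[OF sK] lie_idealD(2)[OF A(1)]
    by (intro subspaceI) (auto simp: C_def lie_add_left lie_smult_left)
  have KC: "K \<subseteq> C"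
    using K(2) lie_idealD(5)[OF K(1)] cA by (auto simp: C_def)
  have "lie_ideal F L C"
  proof (rule lie_idealI[OF sC])
    fix y z assume y: "y \<in> carrier L" and z: "z \<in> C"
    then have zM: "z \<in> M" and zc: "z \<in> carrier L" using cM by (auto simp: C_def)
    obtain a m where am: "a \<in> A" "m \<in> M" "y = a \<oplus>\<^bsub>L\<^esub> m" using decomp[OF y] by blast
    have c: "a \<in> carrier L" "m \<in> carrier L" using am cA cM by blast+
    have "\<lblot>y, z\<rblot>\<^bsub>L\<^esub> = \<lblot>a, z\<rblot>\<^bsub>L\<^esub> \<oplus>\<^bsub>L\<^esub> \<lblot>m, z\<rblot>\<^bsub>L\<^esub>" using am c zc by (simp add: lie_add_left)
    moreover have "\<lblot>a, z\<rblot>\<^bsub>L\<^esub> \<in> C"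
      using z am(1) KC lie_right_mem_iff[OF sK zc c(1)] by (auto simp: C_def)
    moreover have "\<lblot>m, z\<rblot>\<^bsub>L\<^esub> \<in> C"
    proof -
      have "\<lblot>\<lblot>m, z\<rblot>\<^bsub>L\<^esub>, b\<rblot>\<^bsub>L\<^esub> \<in> K" if b: "b \<in> A" for b
      proof -
        have bc: "b \<in> carrier L" using b cA by blast
        have "\<lblot>m, \<lblot>z, b\<rblot>\<^bsub>L\<^esub>\<rblot>\<^bsub>L\<^esub> \<in> K"
          using z b lie_idealD(4)[OF K(1) c(2)] by (simp add: C_def)
        moreover have "\<lblot>z, \<lblot>m, b\<rblot>\<^bsub>L\<^esub>\<rblot>\<^bsub>L\<^esub> \<in> K"
          using z lie_idealD(4)[OF A(1) c(2) b] by (auto simp: C_def)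
        ultimately show ?thesis
          using lie_leibniz[OF c(2) zc bc] subspace_add_cancel_right[OF sK] c zc bc
          by (metis lie_closed)
      qed
      then show ?thesis using am zM lie_subalgebra_lie[OF subM] by (auto simp: C_def)
    qed
    ultimately show "\<lblot>y, z\<rblot>\<^bsub>L\<^esub> \<in> C" using subspaceD(4)[OF sC] by simp
  qed
  then have CK: "C = K" using maxK[of C] KC by (auto simp: C_def)

  text \<open>
    Modulo \<open>K\<close> the map \<open>x \<mapsto> x + [e, x]\<close> with \<open>e \<in> A\<close> is an automorphism, since \<open>A/K\<close> is abelian;
    its inverse is given by \<open>-e\<close>. So it permutes the maximal subalgebras that contain \<open>K\<close>.
  \<close>
  define \<theta> where "\<theta> e S = {x \<in> carrier L. x \<oplus>\<^bsub>L\<^esub> \<lblot>e, x\<rblot>\<^bsub>L\<^esub> \<in> S}" for e S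
  have \<theta>_inv: "x \<oplus>\<^bsub>L\<^esub> \<lblot>e, x\<rblot>\<^bsub>L\<^esub> \<in> \<theta> (\<ominus>\<^bsub>L\<^esub> e) S \<longleftrightarrow> x \<in> S"
    if "e \<in> A" "subspace F S L" "K \<subseteq> S" "x \<in> carrier L" for e S x
  proof -
    have ec: "e \<in> carrier L" using that cA by blast
    have m: "\<lblot>e, \<lblot>e, x\<rblot>\<^bsub>L\<^esub>\<rblot>\<^bsub>L\<^esub> \<in> S" using abel lie_idealD(5)[OF A(1) that(4,1)] that by blast
    have "(x \<oplus>\<^bsub>L\<^esub> \<lblot>e, x\<rblot>\<^bsub>L\<^esub>) \<oplus>\<^bsub>L\<^esub> \<lblot>\<ominus>\<^bsub>L\<^esub> e, x \<oplus>\<^bsub>L\<^esub> \<lblot>e, x\<rblot>\<^bsub>L\<^esub>\<rblot>\<^bsub>L\<^esub> = x \<ominus>\<^bsub>L\<^esub> \<lblot>e, \<lblot>e, x\<rblot>\<^bsub>L\<^esub>\<rblot>\<^bsub>L\<^esub>"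
      using ec that(4)
      by (simp add: lie_neg_left lie_add_right M.minus_add a_minus_def M.a_assoc M.r_neg1 M.r_neg2)
    then show ?thesis
      using subspace_minus_cancel(1)[OF that(2,4) m] ec that(4) by (simp add: \<theta>_def)
  qed
  have \<theta>_sub: "lie_subalgebra F L (\<theta> e S)" and \<theta>_K: "K \<subseteq> \<theta> e S"
    if e: "e \<in> A" and S: "lie_subalgebra F L S" "K \<subseteq> S" for e S
  proof -
    note sS = lie_subalgebra_subspace[OF S(1)]
    have ec: "e \<in> carrier L" using e cA by blast
    show "K \<subseteq> \<theta> e S"
      using S(2) lie_idealD(4)[OF K(1) ec] subspaceD[OF sK] by (auto simp: \<theta>_def)
    show "lie_subalgebra F L (\<theta> e S)"
    proof (intro lie_subalgebraI subspaceI)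
      show "\<theta> e S \<subseteq> carrier L" by (auto simp: \<theta>_def)
      show "\<zero>\<^bsub>L\<^esub> \<in> \<theta> e S" using ec subspaceD(3)[OF sS] by (simp add: \<theta>_def)
      fix x assume x: "x \<in> \<theta> e S"
      show "c \<odot>\<^bsub>L\<^esub> x \<in> \<theta> e S" if "c \<in> carrier F" for c
        using that x ec subspaceD(5)[OF sS, of c "x \<oplus>\<^bsub>L\<^esub> \<lblot>e, x\<rblot>\<^bsub>L\<^esub>"]
        by (simp add: \<theta>_def lie_smult_right smult_r_distr)
      fix y assume y: "y \<in> \<theta> e S"
      have c: "x \<in> carrier L" "y \<in> carrier L" using x y by (auto simp: \<theta>_def)
      have "(x \<oplus>\<^bsub>L\<^esub> y) \<oplus>\<^bsub>L\<^esub> \<lblot>e, x \<oplus>\<^bsub>L\<^esub> y\<rblot>\<^bsub>L\<^esub> = (x \<oplus>\<^bsub>L\<^esub> \<lblot>e, x\<rblot>\<^bsub>L\<^esub>) \<oplus>\<^bsub>L\<^esub> (y \<oplus>\<^bsub>L\<^esub> \<lblot>e, y\<rblot>\<^bsub>L\<^esub>)"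
        using c ec by (simp add: lie_add_right M.a_ac)
      then show "x \<oplus>\<^bsub>L\<^esub> y \<in> \<theta> e S"
        using x y c subspaceD(4)[OF sS] by (simp add: \<theta>_def)
      \<comment> \<open>The failure of \<open>1 + ad e\<close> to preserve brackets is exactly
        \<open>[[e, x], [e, y]]\<close>, a bracket of two elements of \<open>A\<close>, hence in
        \<open>K\<close>.\<close>
      have "\<lblot>x \<oplus>\<^bsub>L\<^esub> \<lblot>e, x\<rblot>\<^bsub>L\<^esub>, y \<oplus>\<^bsub>L\<^esub> \<lblot>e, y\<rblot>\<^bsub>L\<^esub>\<rblot>\<^bsub>L\<^esub> =
          (\<lblot>x, y\<rblot>\<^bsub>L\<^esub> \<oplus>\<^bsub>L\<^esub> \<lblot>e, \<lblot>x, y\<rblot>\<^bsub>L\<^esub>\<rblot>\<^bsub>L\<^esub>) \<oplus>\<^bsub>L\<^esub> \<lblot>\<lblot>e, x\<rblot>\<^bsub>L\<^esub>, \<lblot>e, y\<rblot>\<^bsub>L\<^esub>\<rblot>\<^bsub>L\<^esub>"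
        using c ec lie_leibniz[OF ec c] by (simp add: lie_add_left lie_add_right M.a_ac)
      moreover have "\<lblot>x \<oplus>\<^bsub>L\<^esub> \<lblot>e, x\<rblot>\<^bsub>L\<^esub>, y \<oplus>\<^bsub>L\<^esub> \<lblot>e, y\<rblot>\<^bsub>L\<^esub>\<rblot>\<^bsub>L\<^esub> \<in> S"
        using x y by (intro lie_subalgebra_lie[OF S(1)]) (auto simp: \<theta>_def)
      moreover have "\<lblot>\<lblot>e, x\<rblot>\<^bsub>L\<^esub>, \<lblot>e, y\<rblot>\<^bsub>L\<^esub>\<rblot>\<^bsub>L\<^esub> \<in> S"
        using abel lie_idealD(5)[OF A(1) _ e] c S(2) by blast
      ultimately have "\<lblot>x, y\<rblot>\<^bsub>L\<^esub> \<oplus>\<^bsub>L\<^esub> \<lblot>e, \<lblot>x, y\<rblot>\<^bsub>L\<^esub>\<rblot>\<^bsub>L\<^esub> \<in> S"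
        using subspace_add_cancel_right[OF sS] c ec by simp
      then show "\<lblot>x, y\<rblot>\<^bsub>L\<^esub> \<in> \<theta> e S" using c by (simp add: \<theta>_def)
    qed
  qed
  \<comment> \<open>As \<open>\<theta>\<close> takes preimages, the sign makes this subalgebra the
    image of \<open>M\<close> under \<open>1 + ad a\<close> modulo \<open>K\<close>. A larger
    subalgebra \<open>S\<close> is compared with \<open>M\<close> by moving it back to
    \<open>\<theta> a S\<close>.\<close>
  have max: "maximal_subalgebra F L (\<theta> (\<ominus>\<^bsub>L\<^esub> a) M)" if a: "a \<in> A" for a
  proof -
    have ac: "a \<in> carrier L" using a cA by blast
    have na: "\<ominus>\<^bsub>L\<^esub> a \<in> A" by (rule subspace_neg[OF sA a])
    have "\<theta> (\<ominus>\<^bsub>L\<^esub> a) M \<noteq> carrier L"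
    proof
      assume eq: "\<theta> (\<ominus>\<^bsub>L\<^esub> a) M = carrier L"
      obtain y where y: "y \<in> carrier L" "y \<notin> M" using neM cM by blast
      then have "y \<oplus>\<^bsub>L\<^esub> \<lblot>a, y\<rblot>\<^bsub>L\<^esub> \<notin> \<theta> (\<ominus>\<^bsub>L\<^esub> a) M" using \<theta>_inv[OF a sM K(2)] by simp
      then show False using eq y ac by simp
    qed
    moreover have "S = \<theta> (\<ominus>\<^bsub>L\<^esub> a) M \<or> S = carrier L"
      if S: "lie_subalgebra F L S" "\<theta> (\<ominus>\<^bsub>L\<^esub> a) M \<subseteq> S" for S
    proof -
      note sS = lie_subalgebra_subspace[OF S(1)]
      have KS: "K \<subseteq> S" using \<theta>_K[OF na subM K(2)] S(2) by blast
      have inv: "x \<oplus>\<^bsub>L\<^esub> \<lblot>\<ominus>\<^bsub>L\<^esub> a, x\<rblot>\<^bsub>L\<^esub> \<in> \<theta> a S \<longleftrightarrow> x \<in> S" if "x \<in> carrier L" for x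
        using \<theta>_inv[OF na sS KS that] ac by simp
      have "M \<subseteq> \<theta> a S"
      proof
        fix m assume m: "m \<in> M"
        then have mc: "m \<in> carrier L" using cM by blast
        have "m \<oplus>\<^bsub>L\<^esub> \<lblot>a, m\<rblot>\<^bsub>L\<^esub> \<in> S" using \<theta>_inv[OF a sM K(2) mc] m S(2) by blast
        then show "m \<in> \<theta> a S" using mc by (simp add: \<theta>_def)
      qed
      then consider "\<theta> a S = M" | "\<theta> a S = carrier L"
        using maxM[OF \<theta>_sub[OF a S(1) KS]] by blast
      then show ?thesis
      proof cases
        case 1
        have "S \<subseteq> \<theta> (\<ominus>\<^bsub>L\<^esub> a) M"
          using inv subspaceD(2)[OF sS] unfolding 1 by (auto simp: \<theta>_def)
        then show ?thesis using S(2) by blast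
      next
        case 2
        have "carrier L \<subseteq> S" using inv ac unfolding 2 by auto
        then show ?thesis using subspaceD(1)[OF sS] by blast
      qed
    qed
    ultimately show ?thesis
      using \<theta>_sub[OF na subM K(2)] unfolding maximal_subalgebra_def by blast
  qed
  have "frattini F L \<subseteq> C"
  proof
    fix f assume f: "f \<in> frattini F L"
    then have fM: "f \<in> M" using M by (auto simp: frattini_def)
    then have fc: "f \<in> carrier L" using cM by blast
    have "\<lblot>f, a\<rblot>\<^bsub>L\<^esub> \<in> K" if a: "a \<in> A" for a
    proof -
      have ac: "a \<in> carrier L" using a cA by blast
      \<comment> \<open>Both \<open>f\<close> and \<open>f - [a, f]\<close> lie in \<open>M\<close>,
        so \<open>[a, f]\<close> lies in \<open>A \<inter> M\<close>, which is
        \<open>K\<close>.\<close>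
      have "f \<in> \<theta> (\<ominus>\<^bsub>L\<^esub> a) M" using max[OF a] f by (auto simp: frattini_def)
      then have "\<lblot>\<ominus>\<^bsub>L\<^esub> a, f\<rblot>\<^bsub>L\<^esub> \<in> M"
        using subspace_add_cancel_left[OF sM _ fM] ac fc by (simp add: \<theta>_def)
      then have "\<lblot>f, a\<rblot>\<^bsub>L\<^esub> \<in> M" using ac fc lie_skew[OF fc ac] by (simp add: lie_neg_left)
      moreover have "\<lblot>f, a\<rblot>\<^bsub>L\<^esub> \<in> A" using lie_idealD(4)[OF A(1) fc a] .
      ultimately show ?thesis using AM_K by blast
    qed
    then show "f \<in> C" using fM by (simp add: C_def)
  qed
  then show thesis using that K CK by blast
qed

text \<open>For each maximal subalgebra \<open>M\<close>, the bracket lands in the ideal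
  \<open>K\<close> between the Frattini subalgebra and \<open>M\<close>; \<open>K\<close> may vary
  with \<open>M\<close>.\<close>

lemma lie_ideal_frattini:
  assumes "fin_dim" "lie_solvable F L"
  shows "lie_ideal F L (frattini F L)"
proof (rule lie_idealI)
  show "subspace F (frattini F L) L" unfolding frattini_def
    by (rule subspace_Inter) (simp add: maximal_subalgebra_def lie_subalgebra_subspace)
  fix x y assume x: "x \<in> carrier L" and y: "y \<in> frattini F L"
  have "\<lblot>x, y\<rblot>\<^bsub>L\<^esub> \<in> M" if M: "maximal_subalgebra F L M" for M
  proof -
    obtain K where K: "lie_ideal F L K" "frattini F L \<subseteq> K" "K \<subseteq> M"
      by (rule ideal_between_frattini_and_maximal[OF assms M])
    then show ?thesis using lie_idealD(4)[OF K(1) x] y by blast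
  qed
  moreover have "y \<in> carrier L" using y by (simp add: frattini_def)
  ultimately show "\<lblot>x, y\<rblot>\<^bsub>L\<^esub> \<in> frattini F L" using x by (simp add: frattini_def)
qed

end

section \<open>The upper nilpotent series and extreme algebras\<close>

context lie_algebra
begin

lemma abelian_imp_nilpotent:
  assumes "\<And>x y. x \<in> carrier L \<Longrightarrow> y \<in> carrier L \<Longrightarrow> \<lblot>x, y\<rblot>\<^bsub>L\<^esub> = \<zero>\<^bsub>L\<^esub>"
  shows "lie_nilpotent F L (carrier L)"
proof -
  have "lie_product F L (carrier L) (carrier L) \<subseteq> {\<zero>\<^bsub>L\<^esub>}"
    by (subst lie_product_subset_iff[OF _ _ subspace_zero]) (simp_all add: assms)
  moreover have "\<zero>\<^bsub>L\<^esub> \<in> lie_product F L (carrier L) (carrier L)"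
    using lie_idealD(3)[OF lie_ideal_product[OF lie_ideal_carrier lie_ideal_carrier]] .
  ultimately have "lower_central_series F L (carrier L) (Suc 0) = {\<zero>\<^bsub>L\<^esub>}" by auto
  then show ?thesis unfolding lie_nilpotent_def by (rule exI)
qed

text \<open>The first term is computed in the quotient by zero, whose elements are singleton cosets.
  Nilpotent ideals correspond on both sides, and so do the largest ones.\<close>

lemma upper_nilpotent_series_1:
  assumes fd: "fin_dim"
  shows "upper_nilpotent_series F L (Suc 0) = nilradical F L"
proof -
  interpret Z: lie_algebra_ideal F L "{\<zero>\<^bsub>L\<^esub>}"
    by unfold_locales (rule lie_ideal_zero)
  note R = Z.Q.nilradical_nilpotent_ideal[OF Z.fin_dim_Q[OF fd]]
  note N = nilradical_nilpotent_ideal[OF fd]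
  have nil: "lie_nilpotent F Z.Q (Z.\<pi> ` A) \<longleftrightarrow> lie_nilpotent F L A" if A: "lie_ideal F L A" for A
  proof -
    have "lower_central_series F L A k \<subseteq> {\<zero>\<^bsub>L\<^esub>} \<longleftrightarrow> lower_central_series F L A k = {\<zero>\<^bsub>L\<^esub>}" for k
      using lie_idealD(3)[OF lie_ideal_lower_central_series[OF A], of k] by auto
    then show ?thesis unfolding Z.lie_nilpotent_image_iff[OF A] unfolding lie_nilpotent_def by simp
  qed
  have "Z.\<pi> ` Z.lift (nilradical F Z.Q) = nilradical F Z.Q"
    by (rule Z.image_lift[OF Z.Q.lie_idealD(1)[OF R(1)]])
  then have "Z.lift (nilradical F Z.Q) \<subseteq> nilradical F L"
    using nil[OF Z.lie_ideal_lift[OF R(1)]] R(2)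
    by (intro lie_nilpotent_subset_nilradical Z.lie_ideal_lift R(1)) simp
  moreover have "Z.\<pi> ` nilradical F L \<subseteq> nilradical F Z.Q"
    using nil[OF N(1)] N(2) Z.lie_ideal_image[OF N(1)]
    by (intro Z.Q.lie_nilpotent_subset_nilradical) simp_all
  then have "nilradical F L \<subseteq> Z.lift (nilradical F Z.Q)"
    using lie_idealD(1)[OF N(1)] by (auto simp: Z.lift_def)
  ultimately show ?thesis by (simp add: Z.lift_def[symmetric])
qed

lemma frattini_series_Suc:
  assumes "lie_ideal F L (upper_nilpotent_series F L i)"
  shows "frattini_series F L (Suc i) =
    carrier L \<inter> \<Inter>{M. maximal_subalgebra F L M \<and> upper_nilpotent_series F L i \<subseteq> M}"
proof -
  interpret I: lie_algebra_ideal F L "upper_nilpotent_series F L i"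
    by unfold_locales (rule assms)
  show ?thesis
    using I.lift_frattini by (simp add: frattini_series_def I.lift_def)
qed

lemma frattini_series_1: "frattini_series F L (Suc 0) = frattini F L"
proof -
  have "frattini_series F L (Suc 0) = carrier L \<inter> \<Inter>{M. maximal_subalgebra F L M \<and> {\<zero>\<^bsub>L\<^esub>} \<subseteq> M}"
    using frattini_series_Suc[of 0] by (simp add: lie_ideal_zero)
  moreover have "{M. maximal_subalgebra F L M \<and> {\<zero>\<^bsub>L\<^esub>} \<subseteq> M} = {M. maximal_subalgebra F L M}"
    using subspaceD(3)[OF lie_subalgebra_subspace] by (auto simp: maximal_subalgebra_def)
  ultimately show ?thesis by (simp add: frattini_def)
qed

text \<open>The hypothesis says that \<open>L/N\<close> is its own nilradical, hence nilpotent;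
  pulled back to \<open>L\<close>, the lower central series enters \<open>N\<close>.\<close>

lemma nilpotent_quotient_by_nilradical:
  assumes fd: "fin_dim" and "upper_nilpotent_series F L (Suc (Suc 0)) = carrier L"
  obtains k where "lower_central_series F L (carrier L) k \<subseteq> nilradical F L"
proof -
  interpret N: lie_algebra_ideal F L "nilradical F L"
    by unfold_locales (rule nilradical_nilpotent_ideal[OF fd])
  note R = N.Q.nilradical_nilpotent_ideal[OF N.fin_dim_Q[OF fd]]
  have "N.lift (nilradical F N.Q) = carrier L"
    using assms(2) unfolding N.lift_def upper_nilpotent_series.simps(2)[of F L "Suc 0"]
      upper_nilpotent_series_1[OF fd] .
  then have "nilradical F N.Q = N.\<pi> ` carrier L"
    using N.image_lift[OF N.Q.lie_idealD(1)[OF R(1)]] by simp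
  then have "lie_nilpotent F N.Q (N.\<pi> ` carrier L)" using R(2) by simp
  then show thesis using that N.lie_nilpotent_image_iff[OF lie_ideal_carrier] by blast
qed

text \<open>
  If \<open>\<phi>(L)\<close> were not contained in the nilradical \<open>N\<close>, it would contain an element \<open>z\<close> outside \<open>N\<close> that
  is central modulo \<open>N\<close>; as \<open>ad z\<close> is nilpotent, \<open>N + Fz\<close> would be a larger nilpotent ideal.
\<close>

lemma frattini_subset_nilradical:
  assumes fd: "fin_dim" and sol: "lie_solvable F L"
    and k: "lower_central_series F L (carrier L) k \<subseteq> nilradical F L"
  shows "frattini F L \<subseteq> nilradical F L"
proof (rule ccontr)
  assume not: "\<not> ?thesis"
  note Phi = lie_ideal_frattini[OF fd sol] and N = nilradical_nilpotent_ideal[OF fd]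
  let ?W = "\<lambda>j. frattini F L \<inter> lower_central_series F L (carrier L) j"
  have "?W k \<subseteq> nilradical F L" using k by blast
  moreover have "\<not> ?W 0 \<subseteq> nilradical F L" using not lie_idealD(1)[OF Phi] by auto
  \<comment> \<open>The chain \<phi>(L) \<inter> \<open>L^j\<close> ends inside \<open>N\<close>, so
    there is a last term not contained in \<open>N\<close>. Bracketing an element of it with
    \<open>L\<close> reaches the next term, which is why \<open>z\<close> is central modulo
    \<open>N\<close>.\<close>
  ultimately obtain j where j: "\<not> ?W j \<subseteq> nilradical F L" "?W (Suc j) \<subseteq> nilradical F L"
    using dec_induct[of 0 k "\<lambda>j. \<not> ?W j \<subseteq> nilradical F L"] by blast
  then obtain z where z: "z \<in> ?W j" "z \<notin> nilradical F L" by blast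
  then have zc: "z \<in> carrier L" using lie_idealD(1)[OF Phi] by blast
  have central: "\<lblot>y, z\<rblot>\<^bsub>L\<^esub> \<in> nilradical F L" if y: "y \<in> carrier L" for y
    using j(2) z(1) lie_idealD(4)[OF Phi y] lie_lower_central_series_Suc[OF lie_ideal_carrier y] by blast
  have "\<lblot>z, y\<rblot>\<^bsub>L\<^esub> \<in> frattini F L" if "y \<in> carrier L" for y
    using lie_idealD(5)[OF Phi that] z by blast
  then obtain m where nil: "\<And>y. y \<in> carrier L \<Longrightarrow> (lie_bracket L z ^^ m) y = \<zero>\<^bsub>L\<^esub>"
    using ad_nilpotent_if_image_in_frattini[OF fd zc] by blast
  have sp: "subspace F (span {z}) L" using zc by (simp add: span_is_subspace)
  note sN = lie_ideal_subspace[OF N(1)]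
  have "lie_ideal F L (nilradical F L <+>\<^bsub>L\<^esub> span {z})"
  proof (rule lie_idealI[OF subspace_set_add[OF sN sp]])
    fix y w assume y: "y \<in> carrier L" and w: "w \<in> nilradical F L <+>\<^bsub>L\<^esub> span {z}"
    then obtain n c where nc: "n \<in> nilradical F L" "c \<in> carrier F" "w = n \<oplus>\<^bsub>L\<^esub> c \<odot>\<^bsub>L\<^esub> z"
      using mem_span_singleton[OF zc] by (auto simp: mem_set_add)
    then have "\<lblot>y, w\<rblot>\<^bsub>L\<^esub> = \<lblot>y, n\<rblot>\<^bsub>L\<^esub> \<oplus>\<^bsub>L\<^esub> c \<odot>\<^bsub>L\<^esub> \<lblot>y, z\<rblot>\<^bsub>L\<^esub>"
      using y zc lie_idealD(2)[OF N(1)] by (simp add: lie_add_right lie_smult_right)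
    also have "\<dots> \<in> nilradical F L"
      using central[OF y] nc lie_idealD(4)[OF N(1) y] by (intro subspaceD(4,5)[OF sN])
    finally show "\<lblot>y, w\<rblot>\<^bsub>L\<^esub> \<in> nilradical F L <+>\<^bsub>L\<^esub> span {z}"
      using set_add_upper(1)[OF sN sp] by blast
  qed
  then have "nilradical F L <+>\<^bsub>L\<^esub> span {z} \<subseteq> nilradical F L"
    using lie_nilpotent_adjoin[OF N zc nil] by (intro lie_nilpotent_subset_nilradical)
  moreover have "z \<in> nilradical F L <+>\<^bsub>L\<^esub> span {z}"
    using set_add_upper(2)[OF sN sp] span_self[OF zc] by blast
  ultimately show False using z(2) by blast
qed

text \<open>All brackets fall into \<open>C\<close>, so \<open>C + Fx\<close> is an ideal and fills
  \<open>L\<close> as soon as \<open>x\<close> is outside \<open>C\<close>. The ideal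
  \<open>I\<close> is left general because it is zero when \<open>L\<close> is nilpotent and the
  nilradical otherwise.\<close>

lemma chief_top_imp_one_generated:
  assumes fd: "fin_dim" and sol: "lie_solvable F L" and I: "lie_ideal F L I"
    and C: "C = carrier L \<inter> \<Inter>{M. maximal_subalgebra F L M \<and> I \<subseteq> M}"
    and chief: "chief_factor F L (carrier L) C"
  obtains x where "x \<in> carrier L" "I <+>\<^bsub>L\<^esub> span {x} = carrier L"
proof -
  have iC: "lie_ideal F L C" and CL: "C \<subset> carrier L"
    and min: "\<And>J. lie_ideal F L J \<Longrightarrow> C \<subseteq> J \<Longrightarrow> J \<subseteq> carrier L \<Longrightarrow> J = C \<or> J = carrier L"
    using chief unfolding chief_factor_iff by blast+
  have abel: "\<lblot>a, b\<rblot>\<^bsub>L\<^esub> \<in> C" if "a \<in> carrier L" "b \<in> carrier L" for a b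
    by (rule solvable_minimal_section_abelian[OF sol lie_ideal_carrier iC CL min that])
  obtain x where x: "x \<in> carrier L" "x \<notin> C" using CL by blast
  have sp: "subspace F (span {x}) L" using x by (simp add: span_is_subspace)
  note sC = lie_ideal_subspace[OF iC] and sI = lie_ideal_subspace[OF I]
  note upC = set_add_upper[OF sC sp] and upI = set_add_upper[OF sI sp]
  have cC: "subspace F (C <+>\<^bsub>L\<^esub> span {x}) L" by (rule subspace_set_add[OF sC sp])
  have "lie_ideal F L (C <+>\<^bsub>L\<^esub> span {x})"
    using abel upC(1) subspaceD(2)[OF cC] by (intro lie_idealI[OF cC]) blast
  moreover have "x \<in> C <+>\<^bsub>L\<^esub> span {x}" using upC(2) span_self[OF x(1)] by blast
  ultimately have top: "C <+>\<^bsub>L\<^esub> span {x} = carrier L"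
    using min[of "C <+>\<^bsub>L\<^esub> span {x}"] upC(1) subspaceD(1)[OF cC] x(2) by blast
  have "I <+>\<^bsub>L\<^esub> span {x} = carrier L"
  \<comment> \<open>Non-generators: a maximal subalgebra above \<open>I + Fx\<close> also contains
    \<open>C\<close>, and with it \<open>C + Fx = L\<close>.\<close>
  proof (rule ccontr)
    assume "I <+>\<^bsub>L\<^esub> span {x} \<noteq> carrier L"
    then obtain M where M: "maximal_subalgebra F L M" "I <+>\<^bsub>L\<^esub> span {x} \<subseteq> M"
      using ex_maximal_subalgebra[OF fd lie_subalgebra_set_add[OF I lie_subalgebra_span_singleton[OF x(1)]]] by blast
    then have sM: "subspace F M L" "M \<noteq> carrier L"
      by (auto simp: maximal_subalgebra_def lie_subalgebra_subspace)
    have "C \<subseteq> M" using M upI(1) unfolding C by blast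
    then have "C <+>\<^bsub>L\<^esub> span {x} \<subseteq> M" using M(2) upI(2) by (intro set_add_least[OF sM(1)]) auto
    then show False using top sM subspaceD(1)[OF sM(1)] by blast
  qed
  then show thesis using that x(1) by blast
qed

text \<open>Subtracting the part in \<open>I\<close> from a vector of \<open>W\<close> leaves a
  multiple of \<open>u\<close> in \<open>W\<close>; a nonzero coefficient would put \<open>u\<close>
  and then all of \<open>L\<close> into \<open>W\<close>.\<close>

lemma subspace_above_codim_1:
  assumes I: "subspace F I L" and u: "u \<in> carrier L" and sum: "I <+>\<^bsub>L\<^esub> span {u} = carrier L"
    and W: "subspace F W L" "I \<subseteq> W"
  shows "W = I \<or> W = carrier L"
proof (rule disjCI)
  assume "W \<noteq> carrier L"
  have "W \<subseteq> I"
  proof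
    fix w assume w: "w \<in> W"
    then have "w \<in> I <+>\<^bsub>L\<^esub> span {u}" using subspaceD(2)[OF W(1)] unfolding sum by blast
    then obtain n c where nc: "n \<in> I" "c \<in> carrier F" "w = n \<oplus>\<^bsub>L\<^esub> c \<odot>\<^bsub>L\<^esub> u"
      using mem_span_singleton[OF u] by (auto simp: mem_set_add)
    have cu: "c \<odot>\<^bsub>L\<^esub> u \<in> W"
      using nc w u W(2) subspace_add_cancel_left[OF W(1), of "c \<odot>\<^bsub>L\<^esub> u" n] by auto
    have "c = \<zero>\<^bsub>F\<^esub>"
    proof (rule ccontr)
      assume "c \<noteq> \<zero>\<^bsub>F\<^esub>"
      then have "u \<in> W" using cu subspace_smult_iff[OF W(1) u nc(2)] by simp
      then have "span {u} \<subseteq> W" using u by (subst span_subset_iff[OF W(1)]) auto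
      then have "carrier L \<subseteq> W" using set_add_least[OF W, of "span {u}"] sum by simp
      then show False using \<open>W \<noteq> carrier L\<close> subspaceD(1)[OF W(1)] by blast
    qed
    then show "w \<in> I" using nc u subspaceD(2)[OF I] by simp
  qed
  then show "W = I" using W(2) by blast
qed

text \<open>An ideal of codimension one is itself a maximal subalgebra, so the intersection
  \<open>C\<close> reduces to \<open>I\<close>.\<close>

lemma chief_top_if_codim_1:
  assumes I: "lie_ideal F L I" and u: "u \<in> carrier L" and sum: "I <+>\<^bsub>L\<^esub> span {u} = carrier L"
    and ne: "I \<noteq> carrier L" and C: "C = carrier L \<inter> \<Inter>{M. maximal_subalgebra F L M \<and> I \<subseteq> M}"
  shows "chief_factor F L (carrier L) C"
proof -
  note codim = subspace_above_codim_1[OF lie_ideal_subspace[OF I] u sum]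
  have "maximal_subalgebra F L I"
    using lie_ideal_imp_subalgebra[OF I] ne codim lie_subalgebra_subspace
    unfolding maximal_subalgebra_def by blast
  then have "C = I" using lie_idealD(1)[OF I] unfolding C by blast
  then show ?thesis
    using I ne lie_idealD(1)[OF I] lie_ideal_carrier codim lie_ideal_subspace
    unfolding chief_factor_iff by blast
qed

section \<open>The bottom factor and the decomposition of \<open>L\<close> modulo its Frattini
  ideal\<close>

lemma nilradical_eq_carrier_if_ad_in_frattini:
  assumes fd: "fin_dim" and x: "x \<in> carrier L"
    and sum: "nilradical F L <+>\<^bsub>L\<^esub> span {x} = carrier L"
    and im: "\<And>y. y \<in> carrier L \<Longrightarrow> \<lblot>x, y\<rblot>\<^bsub>L\<^esub> \<in> frattini F L"
  shows "nilradical F L = carrier L"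
proof -
  note N = nilradical_nilpotent_ideal[OF fd]
  obtain m where nil: "\<And>y. y \<in> carrier L \<Longrightarrow> (lie_bracket L x ^^ m) y = \<zero>\<^bsub>L\<^esub>"
    using ad_nilpotent_if_image_in_frattini[OF fd x im] by blast
  have "lie_nilpotent F L (carrier L)"
    using lie_nilpotent_adjoin[OF N x nil] lie_ideal_carrier unfolding sum by simp
  then show ?thesis
    using lie_nilpotent_subset_nilradical[OF lie_ideal_carrier] lie_idealD(1)[OF N(1)] by blast
qed

text \<open>The second alternative of the theorem, with its two subalgebras as parameters, so that
  unfolding it gives the final statement literally. Apart from being subalgebras of
  \<open>L\<close>, the two enter only through their images.\<close>

definition primitive_decomposition :: "'b set \<Rightarrow> 'b set \<Rightarrow> bool" where
  "primitive_decomposition A U \<longleftrightarrow>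
    (let Lbar = lie_quotient L (frattini F L); bar = quotient_image L (frattini F L) in
      lie_subalgebra F L A \<and> lie_subalgebra F L U \<and>
      is_direct_sum Lbar (bar A) (bar U) \<and>
      bar A = bar (nilradical F L) \<and>
      is_monolith F Lbar (bar A) \<and>
      lie_subalgebra F Lbar (bar U) \<and>
      vectorspace.dim F (Lbar\<lparr>carrier := bar U\<rparr>) = 1 \<and>
      acts_irreducibly F Lbar (bar U) (bar A))"

text \<open>The essential point is that \<open>x\<close> acts nontrivially on
  \<open>N/\<phi>(L)\<close>: this makes the monolith unique. Irreducibility is the minimality of
  the chief factor seen from \<open>x\<close>.\<close>

lemma primitive_decomposition_if_chief_factor:
  assumes fd: "fin_dim" and sol: "lie_solvable F L"
    and chief: "chief_factor F L (nilradical F L) (frattini F L)"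
    and x: "x \<in> carrier L" and sum: "nilradical F L <+>\<^bsub>L\<^esub> span {x} = carrier L"
    and ne: "nilradical F L \<noteq> carrier L"
  shows "primitive_decomposition (nilradical F L) (span {x})"
proof -
  define N where "N = nilradical F L"
  define Phi where "Phi = frattini F L"
  have N: "lie_ideal F L N" and Phi: "lie_ideal F L Phi" and PN: "Phi \<subset> N"
    and min: "\<And>J. lie_ideal F L J \<Longrightarrow> Phi \<subseteq> J \<Longrightarrow> J \<subseteq> N \<Longrightarrow> J = Phi \<or> J = N"
    using chief unfolding chief_factor_iff N_def Phi_def by blast+
  interpret P: lie_algebra_ideal F L Phi by unfold_locales (rule Phi)
  note sN = lie_ideal_subspace[OF N] and sPhi = lie_ideal_subspace[OF Phi]
  note cN = lie_idealD(1)[OF N]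
  have sx: "subspace F (span {x}) L" using x by (simp add: span_is_subspace)
  note cx = subspaceD(1)[OF sx]
  have abel: "\<lblot>a, b\<rblot>\<^bsub>L\<^esub> \<in> Phi" if "a \<in> N" "b \<in> N" for a b
    by (rule solvable_minimal_section_abelian[OF sol N Phi PN min that])
  have decomp: "\<exists>n\<in>N. \<exists>c\<in>carrier F. y = n \<oplus>\<^bsub>L\<^esub> c \<odot>\<^bsub>L\<^esub> x" if "y \<in> carrier L" for y
    using that sum[symmetric] by (simp add: mem_set_add_span_singleton[OF x] N_def)
  have xN: "x \<notin> N"
  proof
    assume "x \<in> N"
    then have "span {x} \<subseteq> N" using x by (subst span_subset_iff[OF sN]) auto
    then show False using set_add_least[OF sN subset_refl] sum ne cN unfolding N_def by blast
  qed
  have not_central: "\<exists>n\<in>N. \<lblot>x, n\<rblot>\<^bsub>L\<^esub> \<notin> Phi"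
  proof (rule ccontr)
    assume central: "\<not> ?thesis"
    \<comment> \<open>Since \<open>x\<close> commutes with its own multiples, centralising
      \<open>N\<close> modulo the Frattini ideal would mean
      \<open>[x, L] \<subseteq> \<phi>(L)\<close>.\<close>
    have "\<lblot>x, y\<rblot>\<^bsub>L\<^esub> \<in> frattini F L" if y: "y \<in> carrier L" for y
    proof -
      obtain n c where nc: "n \<in> N" "c \<in> carrier F" "y = n \<oplus>\<^bsub>L\<^esub> c \<odot>\<^bsub>L\<^esub> x" using decomp[OF y] by blast
      then have "\<lblot>x, y\<rblot>\<^bsub>L\<^esub> = \<lblot>x, n\<rblot>\<^bsub>L\<^esub>"
        using x lie_idealD(2)[OF N] by (simp add: lie_add_right lie_smult_right lie_alternating)
      then show ?thesis using central nc(1) unfolding Phi_def by simp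
    qed
    then show False using nilradical_eq_carrier_if_ad_in_frattini[OF fd x sum] ne by blast
  qed

  have "is_direct_sum P.Q (P.\<pi> ` N) (P.\<pi> ` span {x})"
    unfolding is_direct_sum_def
  proof
    show "P.\<pi> ` N <+>\<^bsub>P.Q\<^esub> P.\<pi> ` span {x} = carrier P.Q"
      using sum P.set_add_image[OF cN cx] by (simp add: P.carrier_Q N_def)
    show "P.\<pi> ` N \<inter> P.\<pi> ` span {x} = {\<zero>\<^bsub>P.Q\<^esub>}"
    proof (intro equalityI subsetI)
      fix X assume X: "X \<in> P.\<pi> ` N \<inter> P.\<pi> ` span {x}"
      then obtain y where y: "y \<in> span {x}" "X = P.\<pi> y" by blast
      obtain c where c: "c \<in> carrier F" "y = c \<odot>\<^bsub>L\<^esub> x" using y(1) mem_span_singleton[OF x] by blast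
      have "y \<in> N" using P.\<pi>_mem_image_iff[OF sN, of y] PN X y cx by blast
      then have "c = \<zero>\<^bsub>F\<^esub>" using c xN subspace_smult_iff[OF sN x c(1)] by blast
      then show "X \<in> {\<zero>\<^bsub>P.Q\<^esub>}" using c y x by (simp add: P.zero_Q)
    next
      fix X assume "X \<in> {\<zero>\<^bsub>P.Q\<^esub>}"
      then show "X \<in> P.\<pi> ` N \<inter> P.\<pi> ` span {x}"
        using P.Q.subspaceD(3)[OF P.subspace_image[OF sN]] P.Q.subspaceD(3)[OF P.subspace_image[OF sx]]
        by simp
    qed
  qed
  moreover have "is_monolith F P.Q (P.\<pi> ` N)"
    unfolding is_monolith_def
  proof (intro conjI allI impI)
    show "minimal_ideal F P.Q (P.\<pi> ` N)"
      using P.minimal_ideal_image_iff[OF N] PN min by blast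
    fix X assume X: "minimal_ideal F P.Q X"
    then have iX: "lie_ideal F P.Q X" by (simp add: minimal_ideal_def)
    define J where "J = P.lift X"
    have J: "lie_ideal F L J" unfolding J_def by (rule P.lie_ideal_lift[OF iX])
    have PJ: "Phi \<subseteq> J" unfolding J_def by (rule P.I_subset_lift[OF P.Q.lie_ideal_subspace[OF iX]])
    have XJ: "X = P.\<pi> ` J"
      unfolding J_def by (rule P.image_lift[OF P.Q.lie_idealD(1)[OF iX], symmetric])
    have J_min: "J \<noteq> Phi" "\<And>K. lie_ideal F L K \<Longrightarrow> Phi \<subseteq> K \<Longrightarrow> K \<subseteq> J \<Longrightarrow> K = Phi \<or> K = J"
      using X P.minimal_ideal_image_iff[OF J PJ] unfolding XJ by blast+
    note sJ = lie_ideal_subspace[OF J]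
    \<comment> \<open>An ideal that meets \<open>N\<close> only in the Frattini ideal centralises
      \<open>N\<close> modulo it. An element of it outside \<open>N\<close> has a nonzero
      \<open>x\<close>-part, and its \<open>N\<close>-part acts trivially, so \<open>x\<close> would
      centralise as well.\<close>
    have "J \<inter> N \<noteq> Phi"
    proof
      assume JN: "J \<inter> N = Phi"
      have "\<not> J \<subseteq> N" using JN J_min(1) PJ by blast
      then obtain j where j: "j \<in> J" "j \<notin> N" by blast
      have jc: "j \<in> carrier L" using j lie_idealD(1)[OF J] by blast
      obtain n c where nc: "n \<in> N" "c \<in> carrier F" "j = n \<oplus>\<^bsub>L\<^esub> c \<odot>\<^bsub>L\<^esub> x" using decomp[OF jc] by blast
      have ncar: "n \<in> carrier L" using nc cN by blast
      have "c \<noteq> \<zero>\<^bsub>F\<^esub>" using nc j(2) x ncar by auto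
      have "\<lblot>x, b\<rblot>\<^bsub>L\<^esub> \<in> Phi" if b: "b \<in> N" for b
      proof -
        have bc: "b \<in> carrier L" using b cN by blast
        have "\<lblot>j, b\<rblot>\<^bsub>L\<^esub> \<in> Phi"
          using lie_idealD(5)[OF J bc j(1)] lie_idealD(4)[OF N jc b] JN by blast
        moreover have "\<lblot>j, b\<rblot>\<^bsub>L\<^esub> = \<lblot>n, b\<rblot>\<^bsub>L\<^esub> \<oplus>\<^bsub>L\<^esub> c \<odot>\<^bsub>L\<^esub> \<lblot>x, b\<rblot>\<^bsub>L\<^esub>"
          using nc ncar x bc by (simp add: lie_add_left lie_smult_left)
        ultimately have "c \<odot>\<^bsub>L\<^esub> \<lblot>x, b\<rblot>\<^bsub>L\<^esub> \<in> Phi"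
          using subspace_add_cancel_left[OF sPhi _ abel[OF nc(1) b]] nc x bc by simp
        then show ?thesis
          using subspace_smult_iff[OF sPhi _ nc(2) \<open>c \<noteq> \<zero>\<^bsub>F\<^esub>\<close>] x bc by simp
      qed
      then show False using not_central by blast
    qed
    then have "J \<inter> N = J" using J_min(2)[OF lie_ideal_Int[OF J N]] PJ PN by blast
    then have "J = N" using min[OF J PJ] J_min(1) by blast
    then show "X = P.\<pi> ` N" by (simp add: XJ)
  qed
  moreover have "lie_subalgebra F P.Q (P.\<pi> ` span {x})"
    by (rule P.lie_subalgebra_image[OF lie_subalgebra_span_singleton[OF x]])
  moreover have "vectorspace.dim F (P.Q\<lparr>carrier := P.\<pi> ` span {x}\<rparr>) = 1"
  proof -
    have "P.\<pi> x \<noteq> \<zero>\<^bsub>P.Q\<^esub>" using P.\<pi>_zero_iff[OF x] xN PN by blast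
    moreover have "P.\<pi> x \<in> P.\<pi> ` span {x}" using span_self[OF x] by blast
    ultimately show ?thesis
      using P.Q.dim_subspace_eq_1_iff[OF P.fin_dim_Q[OF fd] P.subspace_image[OF sx]]
        P.span_singleton_image[OF x] by auto
  qed
  moreover have "acts_irreducibly F P.Q (P.\<pi> ` span {x}) (P.\<pi> ` N)"
    unfolding acts_irreducibly_def
  proof (intro conjI ballI allI impI)
    note iN = P.lie_ideal_image[OF N]
    show "subspace F (P.\<pi> ` N) P.Q" by (rule P.subspace_image[OF sN])
    show "\<lblot>u, a\<rblot>\<^bsub>P.Q\<^esub> \<in> P.\<pi> ` N" if "u \<in> P.\<pi> ` span {x}" "a \<in> P.\<pi> ` N" for u a
      using that cx by (intro P.Q.lie_idealD(4)[OF iN]) auto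
    show "P.\<pi> ` N \<noteq> {\<zero>\<^bsub>P.Q\<^esub>}" using P.image_zero_iff[OF sN] PN by blast
    fix W assume W: "subspace F W P.Q \<and> W \<subseteq> P.\<pi> ` N \<and> (\<forall>u\<in>P.\<pi> ` span {x}. \<forall>w\<in>W. \<lblot>u, w\<rblot>\<^bsub>P.Q\<^esub> \<in> W)"
    then have sW: "subspace F W P.Q" by blast
    define J where "J = P.lift W"
    have sJ: "subspace F J L" unfolding J_def by (rule P.subspace_lift[OF sW])
    have PJ: "Phi \<subseteq> J" unfolding J_def by (rule P.I_subset_lift[OF sW])
    have WJ: "W = P.\<pi> ` J" unfolding J_def by (rule P.image_lift[OF P.Q.subspaceD(1)[OF sW], symmetric])
    have "J \<subseteq> P.lift (P.\<pi> ` N)" using W unfolding J_def P.lift_def by blast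
    then have JN: "J \<subseteq> N" using P.lift_image[OF sN] PN by blast
    \<comment> \<open>\<open>N\<close> acts as zero on \<open>N/\<phi>(L)\<close>, so stability
      under multiples of \<open>x\<close> already gives stability under \<open>L\<close>.\<close>
    have "lie_ideal F L J"
    proof (rule lie_idealI[OF sJ])
      fix y w assume y: "y \<in> carrier L" and w: "w \<in> J"
      obtain n c where nc: "n \<in> N" "c \<in> carrier F" "y = n \<oplus>\<^bsub>L\<^esub> c \<odot>\<^bsub>L\<^esub> x" using decomp[OF y] by blast
      have c: "n \<in> carrier L" "w \<in> carrier L" using nc w cN JN by blast+
      have "c \<odot>\<^bsub>L\<^esub> x \<in> span {x}" using nc mem_span_singleton[OF x] by blast
      then have "\<lblot>P.\<pi> (c \<odot>\<^bsub>L\<^esub> x), P.\<pi> w\<rblot>\<^bsub>P.Q\<^esub> \<in> W" using W w unfolding WJ by blast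
      then have "\<lblot>c \<odot>\<^bsub>L\<^esub> x, w\<rblot>\<^bsub>L\<^esub> \<in> J" using nc x c by (simp add: P.\<pi>_lie J_def P.lift_def)
      moreover have "\<lblot>n, w\<rblot>\<^bsub>L\<^esub> \<in> J" using abel[of n w] nc w JN PJ by blast
      ultimately show "\<lblot>y, w\<rblot>\<^bsub>L\<^esub> \<in> J"
        using nc c x subspaceD(4)[OF sJ] by (simp add: lie_add_left)
    qed
    then have "J = Phi \<or> J = N" using min PJ JN by blast
    then show "W = {\<zero>\<^bsub>P.Q\<^esub>} \<or> W = P.\<pi> ` N" unfolding WJ using P.image_I by auto
  qed
  ultimately show ?thesis
    using lie_ideal_imp_subalgebra[OF N] lie_subalgebra_span_singleton[OF x]
    unfolding primitive_decomposition_def quotient_image_def Let_def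
    by (simp add: N_def Phi_def)
qed

text \<open>The vector \<open>u\<close> represents a generator of the one-dimensional image of
  \<open>U\<close>. As \<phi>(L) lies in \<open>N\<close>, both \<open>N\<close> and
  \<open>N + Fu\<close> are preimages of their images, so the sum and the minimality of the monolith
  pull back to \<open>L\<close>.\<close>

lemma primitive_decomposition_imp:
  assumes fd: "fin_dim" and sol: "lie_solvable F L" and dec: "primitive_decomposition A U"
    and PN: "frattini F L \<subseteq> nilradical F L"
  obtains u where "u \<in> carrier L" "nilradical F L <+>\<^bsub>L\<^esub> span {u} = carrier L"
    "nilradical F L \<noteq> carrier L" "chief_factor F L (nilradical F L) (frattini F L)"
proof -
  define N where "N = nilradical F L"
  define Phi where "Phi = frattini F L"
  have N: "lie_ideal F L N" unfolding N_def by (rule nilradical_nilpotent_ideal[OF fd])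
  have Phi: "lie_ideal F L Phi" unfolding Phi_def by (rule lie_ideal_frattini[OF fd sol])
  interpret P: lie_algebra_ideal F L Phi by unfold_locales (rule Phi)
  note sN = lie_ideal_subspace[OF N]
  note d = dec[unfolded primitive_decomposition_def Let_def quotient_image_def is_direct_sum_def
      is_monolith_def, folded N_def Phi_def]
  have AN: "P.\<pi> ` A = P.\<pi> ` N" using d by (elim conjE)
  have U: "lie_subalgebra F L U" using d by (elim conjE)
  have sum: "P.\<pi> ` A <+>\<^bsub>P.Q\<^esub> P.\<pi> ` U = carrier P.Q" using d by (elim conjE)
  have int: "P.\<pi> ` A \<inter> P.\<pi> ` U = {\<zero>\<^bsub>P.Q\<^esub>}" using d by (elim conjE)
  have mono: "minimal_ideal F P.Q (P.\<pi> ` A)" using d by (elim conjE)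
  have dim: "vectorspace.dim F (P.Q\<lparr>carrier := P.\<pi> ` U\<rparr>) = 1" using d by (elim conjE)
  note sU = lie_subalgebra_subspace[OF U]
  obtain X where X: "X \<in> P.\<pi> ` U" "X \<noteq> \<zero>\<^bsub>P.Q\<^esub>" "P.Q.span {X} = P.\<pi> ` U"
    using dim P.Q.dim_subspace_eq_1_iff[OF P.fin_dim_Q[OF fd] P.subspace_image[OF sU]] by blast
  then obtain u where u: "u \<in> U" "X = P.\<pi> u" by blast
  have uc: "u \<in> carrier L" using u subspaceD(1)[OF sU] by blast
  \<comment> \<open>Otherwise the generator \<open>X\<close> of the second summand would also lie in
    the first, against the trivial intersection.\<close>
  have "N \<noteq> carrier L"
  proof
    assume "N = carrier L"
    then have "X \<in> P.\<pi> ` A" using u uc AN by blast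
    then show False using X(1,2) int by blast
  qed
  moreover have "N <+>\<^bsub>L\<^esub> span {u} = carrier L"
  proof
    have su: "subspace F (span {u}) L" using uc by (simp add: span_is_subspace)
    show "N <+>\<^bsub>L\<^esub> span {u} \<subseteq> carrier L" using subspaceD(1)[OF subspace_set_add[OF sN su]] .
    have "P.\<pi> ` U = P.\<pi> ` span {u}" using X(3) P.span_singleton_image[OF uc] u(2) by simp
    then have "P.\<pi> ` (N <+>\<^bsub>L\<^esub> span {u}) = P.\<pi> ` carrier L"
      using sum P.set_add_image[OF lie_idealD(1)[OF N] subspaceD(1)[OF su]]
      by (simp add: AN P.carrier_Q)
    moreover have "Phi \<subseteq> N <+>\<^bsub>L\<^esub> span {u}"
      using PN set_add_upper(1)[OF sN su] unfolding N_def Phi_def by blast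
    ultimately have "N <+>\<^bsub>L\<^esub> span {u} = carrier L"
      using P.image_eq_iff[OF subspace_set_add[OF sN su] _ subspace_carrier lie_idealD(1)[OF Phi]] by blast
    then show "carrier L \<subseteq> N <+>\<^bsub>L\<^esub> span {u}" by simp
  qed
  moreover have "chief_factor F L N Phi"
    using mono[unfolded AN] N Phi PN by (simp add: chief_factor_def quotient_image_def N_def Phi_def)
  ultimately show thesis using that uc unfolding N_def Phi_def by blast
qed

text \<open>The lengths one and two are separated by whether \<open>N = L\<close>. If so, the top
  and bottom factors coincide and only the first alternative can hold, since a decomposition forces
  \<open>N \<noteq> L\<close>. Otherwise dimension one is impossible, because such an algebra is
  abelian.\<close>

lemma extreme_iff:
  assumes fd: "fin_dim" and sol: "lie_solvable F L" and ne0: "carrier L \<noteq> {\<zero>\<^bsub>L\<^esub>}"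
    and len: "nilpotent_length_le F L 2"
  shows "extreme F L \<longleftrightarrow> dim = 1 \<or> (\<exists>A U. primitive_decomposition A U)"
proof -
  let ?N = "nilradical F L" and ?U = "upper_nilpotent_series F L" and ?n = "nilpotent_length F L"
  have U1: "?U (Suc 0) = ?N" by (rule upper_nilpotent_series_1[OF fd])
  obtain m where "?U m = carrier L" using len unfolding nilpotent_length_le_def by blast
  then have Un: "?U ?n = carrier L" unfolding nilpotent_length_def by (rule LeastI)
  have n2: "?n \<le> 2" using len by (simp add: nilpotent_length_le_def)
  \<comment> \<open>The zero algebra has length \<open>0\<close>: it would be extreme vacuously
    although both alternatives fail.\<close>
  have n0: "?n \<noteq> 0" using Un ne0 by (metis upper_nilpotent_series.simps(1))
  have N: "lie_ideal F L ?N" by (rule nilradical_nilpotent_ideal[OF fd])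
  have F1: "frattini_series F L (Suc 0) = frattini F L" by (rule frattini_series_1)
  have F2: "frattini_series F L (Suc (Suc 0)) =
      carrier L \<inter> \<Inter>{M. maximal_subalgebra F L M \<and> ?N \<subseteq> M}"
    using frattini_series_Suc[of "Suc 0"] N unfolding U1 by simp
  have F0: "frattini F L = carrier L \<inter> \<Inter>{M. maximal_subalgebra F L M \<and> {\<zero>\<^bsub>L\<^esub>} \<subseteq> M}"
    using frattini_series_Suc[of 0] F1 by (simp add: lie_ideal_zero)
  \<comment> \<open>Prepares the use of the results on the top factor with the zero ideal, which is
    the case of a nilpotent \<open>L\<close>.\<close>
  have sub0: "{\<zero>\<^bsub>L\<^esub>} <+>\<^bsub>L\<^esub> span {x} = span {x}" if "x \<in> carrier L" for x
    using that set_add_upper(2)[OF subspace_zero span_is_subspace, of "{x}"]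
      set_add_least[OF span_is_subspace, of "{x}" "{\<zero>\<^bsub>L\<^esub>}" "span {x}"] span_zero by auto
  \<comment> \<open>In length one the nilradical is everything; in length two \<open>L/N\<close> is
    nilpotent, and the argument by Fitting's lemma applies.\<close>
  have PN: "frattini F L \<subseteq> ?N"
  proof (cases "?n = 1")
    case True
    then show ?thesis using Un U1 by (auto simp: frattini_def)
  next
    case False
    then have "?n = Suc (Suc 0)" using n0 n2 by simp
    then obtain k where "lower_central_series F L (carrier L) k \<subseteq> ?N"
      using nilpotent_quotient_by_nilradical[OF fd] Un by metis
    then show ?thesis by (rule frattini_subset_nilradical[OF fd sol])
  qed
  show ?thesis
  proof (cases "?N = carrier L")
    case True
    then have "?n \<le> 1" unfolding nilpotent_length_def using U1 by (intro Least_le) simp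
    then have n1: "?n = 1" using n0 by simp
    then have ext: "extreme F L \<longleftrightarrow> chief_factor F L (carrier L) (frattini F L)"
      using U1 F1 True by (simp add: extreme_def)
    have "extreme F L \<longleftrightarrow> dim = 1"
    proof
      assume "extreme F L"
      then obtain x where x: "x \<in> carrier L" "{\<zero>\<^bsub>L\<^esub>} <+>\<^bsub>L\<^esub> span {x} = carrier L"
        using chief_top_imp_one_generated[OF fd sol lie_ideal_zero F0] ext by blast
      then have gen: "span {x} = carrier L" using sub0 by simp
      have "x \<noteq> \<zero>\<^bsub>L\<^esub>"
      proof
        assume "x = \<zero>\<^bsub>L\<^esub>"
        then have "span {x} = {\<zero>\<^bsub>L\<^esub>}" using span_subspace[OF subspace_zero] by simp
        then show False using gen ne0 by simp
      qed
      then show "dim = 1" using dim1I gen x(1) by blast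
    next
      assume "dim = 1"
      then obtain u where "u \<in> carrier L" "span {u} = carrier L"
        using dim_eq_1_iff[OF fd] by blast
      then show "extreme F L"
        unfolding ext using sub0 ne0 by (intro chief_top_if_codim_1[OF lie_ideal_zero _ _ _ F0]) auto
    qed
    moreover have "\<not> primitive_decomposition A U" for A U
      using primitive_decomposition_imp[OF fd sol _ PN] True by blast
    ultimately show ?thesis by blast
  next
    case False
    then have "?n \<noteq> 1" using Un U1 by auto
    then have n: "?n = Suc (Suc 0)" using n0 n2 by simp
    have "{1..Suc (Suc 0)} = {Suc 0, Suc (Suc 0)}" by auto
    then have ext: "extreme F L \<longleftrightarrow> chief_factor F L ?N (frattini F L) \<and>
        chief_factor F L (carrier L) (frattini_series F L (Suc (Suc 0)))"
      using U1 F1 Un n by (simp add: extreme_def)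
    have "dim \<noteq> 1"
    proof
      assume "dim = 1"
      then obtain x where x: "x \<in> carrier L" "span {x} = carrier L"
        using dim_eq_1_iff[OF fd] by blast
      have "\<lblot>a, b\<rblot>\<^bsub>L\<^esub> = \<zero>\<^bsub>L\<^esub>" if "a \<in> carrier L" "b \<in> carrier L" for a b
      proof -
        have "a \<in> span {x}" "b \<in> span {x}" using that x(2) by simp_all
        then show ?thesis
          using x(1) by (auto simp: mem_span_singleton lie_smult_left lie_smult_right lie_alternating)
      qed
      then have "carrier L \<subseteq> ?N"
        using lie_nilpotent_subset_nilradical[OF lie_ideal_carrier abelian_imp_nilpotent] by blast
      then show False using False lie_idealD(1)[OF N] by blast
    qed
    moreover have "extreme F L \<longleftrightarrow> (\<exists>A U. primitive_decomposition A U)"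
    proof
      assume e: "extreme F L"
      then obtain x where x: "x \<in> carrier L" "?N <+>\<^bsub>L\<^esub> span {x} = carrier L"
        using chief_top_imp_one_generated[OF fd sol N F2] ext by blast
      then show "\<exists>A U. primitive_decomposition A U"
        using primitive_decomposition_if_chief_factor[OF fd sol _ x False] e ext by blast
    next
      assume "\<exists>A U. primitive_decomposition A U"
      then obtain A U where "primitive_decomposition A U" by blast
      then obtain u where "u \<in> carrier L" "?N <+>\<^bsub>L\<^esub> span {u} = carrier L"
        "chief_factor F L ?N (frattini F L)"
        using primitive_decomposition_imp[OF fd sol _ PN] by blast
      then show "extreme F L"
        unfolding ext using chief_top_if_codim_1[OF N _ _ False F2] by blast
    qed
    ultimately show ?thesis by blast
  qed
qed

end

theorem corollary3p6:
  fixes F :: "('a, 'm) ring_scheme" and L :: "('a, 'b) lie_struct"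
  assumes "lie_algebra F L"
    and "vectorspace.fin_dim F L"
    and "lie_solvable F L"
    and "carrier L \<noteq> {\<zero>\<^bsub>L\<^esub>}"
    and "nilpotent_length_le F L 2"
  shows "extreme F L \<longleftrightarrow>
    vectorspace.dim F L = 1 \<or>
    (let Lbar = lie_quotient L (frattini F L);
         bar = quotient_image L (frattini F L)
     in \<exists>A U. lie_subalgebra F L A \<and> lie_subalgebra F L U \<and>
          is_direct_sum Lbar (bar A) (bar U) \<and>
          bar A = bar (nilradical F L) \<and>
          is_monolith F Lbar (bar A) \<and>
          lie_subalgebra F Lbar (bar U) \<and>
          vectorspace.dim F (Lbar\<lparr>carrier := bar U\<rparr>) = 1 \<and>
          acts_irreducibly F Lbar (bar U) (bar A))"
proof -
  interpret lie_algebra F L by (rule assms(1))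
  show ?thesis
    using extreme_iff[OF assms(2-5)] unfolding primitive_decomposition_def Let_def .
qed

end
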